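(* Let $X$ be a standard Borel space, let $k \in \mathbb{N}^+$, and let $\mathscr{B} \colon X \to^? k$ be a Borel constraint satisfaction problem with $\mathsf{vdeg}(\mathscr{B}) < \infty$ and $\mathsf{ord}(\mathscr{B}) < \infty$. If $$\mathsf{p}(\mathscr{B}) \cdot \mathsf{vdeg}(\mathscr{B})^{\mathsf{ord}(\mathscr{B})} \,<\, 1,$$ then $\mathscr{B}$ has a Borel solution $f \colon X \to k$.
   Context: The integer $k$ is identified with the discrete set $\{0,1,\ldots,k-1\}$. A $k$-coloring of a set $S$ is a function $S \to k$. For a set $X$ and a finite set $D \subseteq X$, an $(X,k)$-constraint with domain $D$ is a set $B \subseteq k^D$ of $k$-colorings of $D$; write $\mathrm{dom}(B) = D$. A coloring $f \colon X \to k$ violates $B$ if $f|_D \in B$, and satisfies $B$ otherwise. A constraint satisfaction problem (CSP) $\mathscr{B} \colon X \to^? k$ is a set of $(X,k)$-constraints. A solution to $\mathscr{B}$ is a coloring $f \colon X \to k$ that satisfies every $B \in \mathscr{B}$. Parameters: $\mathbb{P}[B] = |B|/k^{|\mathrm{dom}(B)|}$, $\mathsf{p}(\mathscr{B}) = \sup_{B \in \mathscr{B}} \mathbb{P}[B]$, $\mathsf{vdeg}(\mathscr{B}) = \sup_{x \in X} |\{B \in \mathscr{B} : x \in \mathrm{dom}(B)\}|$, $\mathsf{ord}(\mathscr{B}) = \sup_{B \in \mathscr{B}} |\mathrm{dom}(B)|$. The expression $0^0$ is interpreted as $1$. A standard Borel space is a set equipped with a $\sigma$-algebra of Borel sets generated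 by a Polish (separable, completely metrizable) topology. For a standard Borel space $Z$, let $[Z]^{<\infty}$ be the set of all finite subsets of $Z$ with its natural standard Borel structure (a set $A \subseteq [Z]^{<\infty}$ is Borel iff for every $n$ the set $\{(z_1,\ldots,z_n) \in Z^n : \{z_1,\ldots,z_n\} \in A\}$ is Borel). Viewing a function from a finite subset of $X$ to $k$ as a finite subset of $X \times k$, every $(X,k)$-constraint is a finite subset of $[X \times k]^{<\infty}$; a CSP $\mathscr{B} \colon X \to^? k$ is Borel if it is a Borel subset of $[[X \times k]^{<\infty}]^{<\infty}$. *)

theory Defs
  imports "HOL-Analysis.Analysis"
begin

section \<open>Standard Borel spaces and finite subsets\<close>

text \<open>Only the space and the \<open>\<sigma>\<close>-algebra of a \<^typ>\<open>'a measure\<close> matter here.\<close>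

definition standard_borel :: "'a measure \<Rightarrow> bool" where
  "standard_borel M \<longleftrightarrow>
     (\<exists>T. topspace T = space M \<and> completely_metrizable_space T \<and> separable_space T \<and>
          sets M = sigma_sets (space M) {U. openin T U})"

text \<open>
  The space \<open>[Z]\<^bsup><\<infinity>\<^esup>\<close> of finite subsets of \<open>Z\<close>, where \<open>Z\<^sup>n\<close> is the
  product \<open>\<sigma>\<close>-algebra on tuples indexed by \<open>{..<n}\<close>. The generating family below is
  already a \<open>\<sigma>\<close>-algebra; see \<open>sets_finite_subsets\<close>.
\<close>

definition finite_subsets :: "'a measure \<Rightarrow> 'a set measure" where
  "finite_subsets Z = sigma {F. finite F \<and> F \<subseteq> space Z}
     {A. A \<subseteq> {F. finite F \<and> F \<subseteq> space Z} \<and>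
         (\<forall>n::nat. {z \<in> space (\<Pi>\<^sub>M i\<in>{..<n}. Z). z ` {..<n} \<in> A} \<in> sets (\<Pi>\<^sub>M i\<in>{..<n}. Z))}"

lemma space_finite_subsets: "space (finite_subsets Z) = {F. finite F \<and> F \<subseteq> space Z}"
  unfolding finite_subsets_def by (rule space_measure_of) auto

lemma sets_finite_subsets:
  "A \<in> sets (finite_subsets Z) \<longleftrightarrow>
     A \<subseteq> {F. finite F \<and> F \<subseteq> space Z} \<and>
     (\<forall>n::nat. {z \<in> space (\<Pi>\<^sub>M i\<in>{..<n}. Z). z ` {..<n} \<in> A} \<in> sets (\<Pi>\<^sub>M i\<in>{..<n}. Z))"
proof -
  define \<Omega> where "\<Omega> = {F. finite F \<and> F \<subseteq> space Z}"
  define P where "P n = (\<Pi>\<^sub>M i\<in>{..<n}. Z)" for n :: nat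
  define \<A> where "\<A> = {A. A \<subseteq> \<Omega> \<and> (\<forall>n. {z \<in> space (P n). z ` {..<n} \<in> A} \<in> sets (P n))}"
  have img: "z ` {..<n} \<in> \<Omega>" if "z \<in> space (P n)" for z n
    using that by (auto simp: P_def \<Omega>_def space_PiM)
  have "sigma_algebra \<Omega> \<A>"
    unfolding sigma_algebra_iff2
  proof (intro conjI ballI allI impI)
    show "\<A> \<subseteq> Pow \<Omega>" "{} \<in> \<A>"
      by (auto simp: \<A>_def)
  next
    fix A assume A: "A \<in> \<A>"
    have "{z \<in> space (P n). z ` {..<n} \<in> \<Omega> - A}
            = space (P n) - {z \<in> space (P n). z ` {..<n} \<in> A}" for n
      using img by auto
    with A show "\<Omega> - A \<in> \<A>"
      by (auto simp: \<A>_def)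
  next
    fix A :: "nat \<Rightarrow> _" assume A: "range A \<subseteq> \<A>"
    have "{z \<in> space (P n). z ` {..<n} \<in> (\<Union>i. A i)}
            = (\<Union>i. {z \<in> space (P n). z ` {..<n} \<in> A i})" for n
      by auto
    moreover have "(\<Union>i. {z \<in> space (P n). z ` {..<n} \<in> A i}) \<in> sets (P n)" for n
    proof (intro sets.countable_nat_UN subsetI)
      fix S assume "S \<in> range (\<lambda>i. {z \<in> space (P n). z ` {..<n} \<in> A i})"
      then show "S \<in> sets (P n)"
        using A unfolding \<A>_def by blast
    qed
    ultimately have "{z \<in> space (P n). z ` {..<n} \<in> (\<Union>i. A i)} \<in> sets (P n)" for n
      by simp
    moreover have "(\<Union>i. A i) \<subseteq> \<Omega>"
      using A unfolding \<A>_def by blast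
    ultimately show "(\<Union>i. A i) \<in> \<A>"
      unfolding \<A>_def by blast
  qed
  then have "sets (sigma \<Omega> \<A>) = \<A>"
    by (rule sigma_algebra.sets_measure_of_eq)
  moreover have "finite_subsets Z = sigma \<Omega> \<A>"
    unfolding finite_subsets_def \<A>_def \<Omega>_def P_def ..
  ultimately have "A \<in> sets (finite_subsets Z) \<longleftrightarrow> A \<in> \<A>"
    by simp
  then show ?thesis
    unfolding \<A>_def \<Omega>_def P_def by (simp only: mem_Collect_eq)
qed


section \<open>Constraint satisfaction problems\<close>

text \<open>
  The number \<open>k\<close> is \<open>{..<k}\<close>, and a coloring of a finite set \<open>D\<close> is a partial map with
  domain \<open>D\<close>, so that a coloring determines its domain.
\<close>

definition partial_colorings :: "'a set \<Rightarrow> nat \<Rightarrow> ('a \<rightharpoonup> nat) set" where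
  "partial_colorings D k = {c. dom c = D \<and> ran c \<subseteq> {..<k}}"

definition is_constraint :: "'a set \<Rightarrow> nat \<Rightarrow> ('a \<rightharpoonup> nat) set \<Rightarrow> bool" where
  "is_constraint X k B \<longleftrightarrow> (\<exists>D. finite D \<and> D \<subseteq> X \<and> B \<subseteq> partial_colorings D k)"

text \<open>
  A nonempty constraint determines its domain (\<open>constraint_dom_eq\<close>). The empty constraint,
  which is always satisfied, gets the empty domain.
\<close>

definition constraint_dom :: "('a \<rightharpoonup> nat) set \<Rightarrow> 'a set" where
  "constraint_dom B = (\<Union>c\<in>B. dom c)"

lemma constraint_dom_eq:
  "B \<subseteq> partial_colorings D k \<Longrightarrow> B \<noteq> {} \<Longrightarrow> constraint_dom B = D"
  by (auto simp: constraint_dom_def partial_colorings_def)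

definition violates :: "('a \<Rightarrow> nat) \<Rightarrow> ('a \<rightharpoonup> nat) set \<Rightarrow> bool" where
  "violates f B \<longleftrightarrow> (Some \<circ> f) |` constraint_dom B \<in> B"

definition is_csp :: "'a set \<Rightarrow> nat \<Rightarrow> ('a \<rightharpoonup> nat) set set \<Rightarrow> bool" where
  "is_csp X k \<B> \<longleftrightarrow> (\<forall>B\<in>\<B>. is_constraint X k B)"

definition is_solution :: "'a set \<Rightarrow> nat \<Rightarrow> ('a \<rightharpoonup> nat) set set \<Rightarrow> ('a \<Rightarrow> nat) \<Rightarrow> bool" where
  "is_solution X k \<B> f \<longleftrightarrow> f \<in> X \<rightarrow> {..<k} \<and> (\<forall>B\<in>\<B>. \<not> violates f B)"

definition constraint_prob :: "nat \<Rightarrow> ('a \<rightharpoonup> nat) set \<Rightarrow> real" where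
  "constraint_prob k B = real (card B) / real k ^ card (constraint_dom B)"

text \<open>
  The suprema are taken in \<^typ>\<open>ennreal\<close> and \<^typ>\<open>enat\<close>, where the supremum of the empty set is \<open>0\<close>.
\<close>

definition csp_prob :: "nat \<Rightarrow> ('a \<rightharpoonup> nat) set set \<Rightarrow> ennreal" where
  "csp_prob k \<B> = (SUP B\<in>\<B>. ennreal (constraint_prob k B))"

definition set_size :: "'b set \<Rightarrow> enat" where
  "set_size S = (if finite S then enat (card S) else \<infinity>)"

definition csp_vdeg :: "'a set \<Rightarrow> ('a \<rightharpoonup> nat) set set \<Rightarrow> enat" where
  "csp_vdeg X \<B> = (SUP x\<in>X. set_size {B\<in>\<B>. x \<in> constraint_dom B})"

definition csp_ord :: "('a \<rightharpoonup> nat) set set \<Rightarrow> enat" where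
  "csp_ord \<B> = (SUP B\<in>\<B>. set_size (constraint_dom B))"

text \<open>
  Identifying partial maps with their graphs turns a constraint into a finite set of finite
  subsets of \<open>X \<times> k\<close>.
\<close>

definition borel_csp :: "'a measure \<Rightarrow> nat \<Rightarrow> ('a \<rightharpoonup> nat) set set \<Rightarrow> bool" where
  "borel_csp M k \<B> \<longleftrightarrow> is_csp (space M) k \<B> \<and>
     (\<lambda>B. Map.graph ` B) ` \<B>
       \<in> sets (finite_subsets (finite_subsets (M \<Otimes>\<^sub>M count_space {..<k})))"

end

theory Submission
  imports Defs
begin

text \<open>
  Two constraints that share a variable have to be decoupled, and all choices have to be Borel.

  The combinatorial part derandomizes the union bound. Let \<open>d = vdeg(\<B>)\<close>. Fix a coloring
  \<open>h : X \<rightarrow> \<nat>\<close> that is injective on the domain of every constraint, and give colors to the points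
  in stages: stage \<open>t\<close> treats all \<open>x\<close> with \<open>h x = t\<close> simultaneously. Such points do not share
  constraints, so the choices of one stage do not interact. For \<open>x\<close> and a constraint \<open>B\<close> around \<open>x\<close>,
  the conditional probability that \<open>B\<close> ends up violated, given the colors so far and the color
  \<open>c\<close> at \<open>x\<close>, averages over \<open>c\<close> to its value before the choice. As at most \<open>d\<close> constraints contain
  \<open>x\<close>, the ratios new/old, summed over these constraints, have average at most \<open>d\<close>, so some \<open>c\<close>
  increases none of the probabilities by a factor greater than \<open>d\<close>
  (\<open>exists_color_by_averaging\<close>). After all the points of \<open>dom B\<close> are colored, the conditional
  probability is at most \<open>p d\<^bsup>|dom B|\<^esup> < 1\<close>, and it is \<open>0\<close> or \<open>1\<close>; hence \<open>B\<close> is satisfied. The values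
  of \<open>h\<close> may be unbounded, because the finite set \<open>dom B\<close> is colored after finitely many stages.

  Both \<open>h\<close> and the color of a point at its stage are choices of a natural number
  \<open>g x\<close> that avoids a set of bad values: the number \<open>n\<close> is bad for \<open>x\<close> if some constraint around \<open>x\<close>,
  listed as a tuple of points, has a Borel property depending on \<open>n\<close> (or, in the case of \<open>h\<close>, if \<open>x\<close> is
  outside the \<open>n\<close>th set of a countable separating family of Borel sets). The set of \<open>x\<close> for which \<open>n\<close>
  is bad is therefore a countable union of projections of Borel sets, hence analytic, and there is a value that is not
  bad for each \<open>x\<close>. By Novikov's separation theorem (\<open>novikov_separation\<close>), countably many analytic
  sets with empty intersection can be enlarged to Borel sets with empty intersection; taking
  \<open>g x\<close> to be the least \<open>n\<close> for which \<open>x\<close> is outside the enlarged set is then a Borel choice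
  (\<open>measurable_choice\<close>).

  Constraints are translated to tuples by listing their domain: for a finite set \<open>S\<close> of color
  patterns of length \<open>m\<close>, the tuples \<open>y \<in> X\<^sup>m\<close> for which \<open>{j \<mapsto> s j at y j | s \<in> S}\<close> is a
  constraint of \<open>\<B>\<close> form a Borel set (\<open>codes_sets\<close>), by the definition of the Borel structure on
  finite subsets.
\<close>

section \<open>Analytic sets\<close>

text \<open>
  Continuous images of closed subsets of the Baire space. Allowing a closed subset instead of the
  whole space makes preimages of closed sets immediate and covers the empty set.
\<close>

definition analytic_in :: "'a topology \<Rightarrow> 'a set \<Rightarrow> bool" where
  "analytic_in T A \<longleftrightarrow>
     (\<exists>(F :: (nat \<Rightarrow> nat) set) f. closed F \<and> continuous_map (top_of_set F) T f \<and> f ` F = A)"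

lemma analytic_in_subset: "analytic_in T A \<Longrightarrow> A \<subseteq> topspace T"
  by (auto simp: analytic_in_def continuous_map_def Pi_iff)

lemma analytic_in_empty: "analytic_in T {}"
  unfolding analytic_in_def by (intro exI[of _ "{}"]) auto

lemma analytic_in_image:
  assumes "analytic_in T A" "continuous_map T T' g"
  shows "analytic_in T' (g ` A)"
proof -
  obtain F f where "closed (F :: (nat \<Rightarrow> nat) set)" "continuous_map (top_of_set F) T f" "f ` F = A"
    using assms(1) unfolding analytic_in_def by blast
  then show ?thesis
    unfolding analytic_in_def using assms(2)
    by (intro exI[of _ F] exI[of _ "g \<circ> f"]) (auto intro: continuous_map_compose)
qed

lemma analytic_in_Int_closedin:
  assumes "analytic_in T A" "closedin T C"
  shows "analytic_in T (A \<inter> C)"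
proof -
  obtain F f where F: "closed (F :: (nat \<Rightarrow> nat) set)" and f: "continuous_map (top_of_set F) T f"
    and A: "f ` F = A"
    using assms(1) unfolding analytic_in_def by blast
  have "closedin (top_of_set F) {x \<in> topspace (top_of_set F). f x \<in> C}"
    by (rule closedin_continuous_map_preimage[OF f assms(2)])
  then have "closed {x \<in> F. f x \<in> C}"
    using F by (auto intro: closedin_closed_trans)
  moreover have "continuous_map (top_of_set {x \<in> F. f x \<in> C}) T f"
    using continuous_map_from_subtopology[OF f, of "{x \<in> F. f x \<in> C}"]
    by (simp add: subtopology_subtopology inf.absorb2)
  moreover have "f ` {x \<in> F. f x \<in> C} = A \<inter> C"
    using A by auto
  ultimately show ?thesis
    unfolding analytic_in_def by blast
qed

text \<open>
  A point of the Baire space is read as a matrix whose \<open>n\<close>th row parametrizes the \<open>n\<close>th factor.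
\<close>

lemma analytic_in_PiE:
  fixes I :: "nat set"
  assumes "\<And>n. n \<in> I \<Longrightarrow> analytic_in (T n) (A n)"
  shows "analytic_in (product_topology T I) (PiE I A)"
proof -
  have "\<forall>n\<in>I. \<exists>F f. closed (F :: (nat \<Rightarrow> nat) set) \<and> continuous_map (top_of_set F) (T n) f \<and> f ` F = A n"
    using assms unfolding analytic_in_def by blast
  then obtain F f where F: "\<And>n. n \<in> I \<Longrightarrow> closed (F n :: (nat \<Rightarrow> nat) set)"
    and f: "\<And>n. n \<in> I \<Longrightarrow> continuous_map (top_of_set (F n)) (T n) (f n)"
    and im: "\<And>n. n \<in> I \<Longrightarrow> f n ` F n = A n"
    by metis
  define row where "row y n = (\<lambda>j. y (prod_encode (n, j)))" for y :: "nat \<Rightarrow> nat" and n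
  define G where "G = {y. \<forall>n\<in>I. row y n \<in> F n}"
  define g where "g y = (\<lambda>n\<in>I. f n (row y n))" for y
  have row: "continuous_on S (\<lambda>y. row y n)" for n S
    unfolding row_def by (intro continuous_on_coordinatewise_then_product) 
      (auto intro: continuous_on_subset[OF continuous_on_product_coordinates])
  have "closed G"
  proof -
    have "G = (\<Inter>n\<in>I. (\<lambda>y. row y n) -` F n)"
      by (auto simp: G_def)
    also have "closed \<dots>"
      using F row by (intro closed_INT ballI closed_vimage) auto
    finally show ?thesis .
  qed
  moreover have "continuous_map (top_of_set G) (product_topology T I) g"
    unfolding continuous_map_componentwise
  proof (intro conjI ballI)
    show "g ` topspace (top_of_set G) \<subseteq> extensional I"
      by (auto simp: g_def)
    fix n assume n: "n \<in> I"
    have "continuous_map (top_of_set G) (top_of_set (F n)) (\<lambda>y. row y n)"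
      using row n by (auto simp: G_def)
    from continuous_map_compose[OF this f[OF n]]
    show "continuous_map (top_of_set G) (T n) (\<lambda>x. g x n)"
      using n by (simp add: g_def o_def)
  qed
  moreover have "g ` G = PiE I A"
  proof
    show "g ` G \<subseteq> PiE I A"
      by (auto simp: g_def G_def im[symmetric])
    show "PiE I A \<subseteq> g ` G"
    proof
      fix z assume z: "z \<in> PiE I A"
      then have "\<forall>n\<in>I. \<exists>u\<in>F n. f n u = z n"
        by (auto simp: PiE_iff im[symmetric] image_iff eq_commute)
      then obtain u where u: "\<And>n. n \<in> I \<Longrightarrow> u n \<in> F n \<and> f n (u n) = z n"
        by metis
      define y where "y t = u (fst (prod_decode t)) (snd (prod_decode t))" for t
      have "row y n = u n" for n
        by (auto simp: row_def y_def)
      then have "y \<in> G" "g y = z"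
        using u z by (auto simp: G_def g_def PiE_iff extensional_def restrict_def)
      then show "z \<in> g ` G" by blast
    qed
  qed
  ultimately show ?thesis
    unfolding analytic_in_def by blast
qed

text \<open>
  The first entry of a sequence selects the set, the remaining entries parametrize a point of it.
\<close>

lemma analytic_in_UN_nat:
  assumes "\<And>n :: nat. analytic_in T (A n)"
  shows "analytic_in T (\<Union>n. A n)"
proof -
  have "\<forall>n. \<exists>F f. closed (F :: (nat \<Rightarrow> nat) set) \<and> continuous_map (top_of_set F) T f \<and> f ` F = A n"
    using assms unfolding analytic_in_def by blast
  then obtain F f where F: "\<And>n. closed (F n :: (nat \<Rightarrow> nat) set)"
    and f: "\<And>n. continuous_map (top_of_set (F n)) T (f n)"
    and im: "\<And>n. f n ` F n = A n"
    by metis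
  define tail where "tail y = (\<lambda>j. y (Suc j))" for y :: "nat \<Rightarrow> nat"
  define G where "G = {y. tail y \<in> F (y 0)}"
  define g where "g y = f (y 0) (tail y)" for y
  have tail: "continuous_on S tail" for S
    unfolding tail_def by (intro continuous_on_coordinatewise_then_product) 
      (auto intro: continuous_on_subset[OF continuous_on_product_coordinates])
  have head: "open ((\<lambda>y. y 0) -` N)" for N :: "nat set"
    by (intro open_vimage continuous_on_product_coordinates open_discrete)
  have "open (- G)"
  proof -
    have "- G = (\<Union>n. (\<lambda>y. y 0) -` {n} \<inter> tail -` (- F n))"
      by (auto simp: G_def)
    also have "open \<dots>"
      using F by (intro open_UN ballI open_Int head open_vimage[OF _ tail]) auto
    finally show ?thesis .
  qed
  then have "closed G"
    by (simp add: closed_def)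
  moreover have "continuous_map (top_of_set G) T g"
  proof (rule pasting_lemma[where I = UNIV and T = "\<lambda>n. G \<inter> (\<lambda>y. y 0) -` {n}" and f = "\<lambda>n y. f n (tail y)"])
    fix n :: nat
    show "openin (top_of_set G) (G \<inter> (\<lambda>y. y 0) -` {n})"
      using head by (auto intro: openin_open_Int)
    have "continuous_map (top_of_set (G \<inter> (\<lambda>y. y 0) -` {n})) (top_of_set (F n)) tail"
      using tail by (auto simp: G_def)
    from continuous_map_compose[OF this f]
    show "continuous_map (subtopology (top_of_set G) (G \<inter> (\<lambda>y. y 0) -` {n})) T (\<lambda>y. f n (tail y))"
      by (simp add: subtopology_subtopology o_def)
  qed (auto simp: g_def)
  moreover have "g ` G = (\<Union>n. A n)"
  proof
    show "g ` G \<subseteq> (\<Union>n. A n)"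
      using im by (auto simp: g_def G_def)
    show "(\<Union>n. A n) \<subseteq> g ` G"
    proof safe
      fix z n assume "z \<in> A n"
      then obtain u where u: "u \<in> F n" "f n u = z"
        by (auto simp: im[symmetric])
      then have "case_nat n u \<in> G" "g (case_nat n u) = z"
        by (auto simp: G_def g_def tail_def)
      then show "z \<in> g ` G" by blast
    qed
  qed
  ultimately show ?thesis
    unfolding analytic_in_def by blast
qed

lemma analytic_in_UN:
  assumes "countable J" "\<And>j. j \<in> J \<Longrightarrow> analytic_in T (A j)"
  shows "analytic_in T (\<Union>j\<in>J. A j)"
proof (cases "J = {}")
  case False
  then have "(\<Union>j\<in>J. A j) = (\<Union>n. A (from_nat_into J n))"
    using assms(1) by (metis (no_types) UN_extend_simps(10) range_from_nat_into)
  with False assms show ?thesis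
    by (auto intro!: analytic_in_UN_nat from_nat_into)
qed (simp add: analytic_in_empty)

text \<open>
  The intersection is the image, under the projection to one coordinate, of the part of the product
  \<open>\<Prod>\<^sub>n A n\<close> on the diagonal, and the diagonal is closed in a Hausdorff space.
\<close>

lemma analytic_in_INT_nat:
  assumes "Hausdorff_space T" "\<And>n :: nat. analytic_in T (A n)"
  shows "analytic_in T (\<Inter>n. A n)"
proof -
  let ?P = "product_topology (\<lambda>_. T) (UNIV :: nat set)"
  have proj: "continuous_map ?P T (\<lambda>y. y n)" for n
    using continuous_map_product_projection[of n UNIV "\<lambda>_. T"] by simp
  define \<Delta> where "\<Delta> = {y \<in> topspace ?P. \<forall>n. y n = y 0}"
  have "closedin ?P {y \<in> topspace ?P. y n = y 0}" for n
    by (rule closedin_continuous_maps_eq[OF assms(1), where f = "\<lambda>y. y n" and g = "\<lambda>y. y 0"])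
      (rule proj)+
  then have "closedin ?P (\<Inter>n. {y \<in> topspace ?P. y n = y 0})"
    by (intro closedin_INT) simp_all
  also have "(\<Inter>n. {y \<in> topspace ?P. y n = y 0}) = \<Delta>"
    by (auto simp: \<Delta>_def)
  finally have "analytic_in ?P (PiE UNIV A \<inter> \<Delta>)"
    using assms(2) by (intro analytic_in_Int_closedin analytic_in_PiE)
  then have "analytic_in T ((\<lambda>y. y 0) ` (PiE UNIV A \<inter> \<Delta>))"
    by (rule analytic_in_image) (rule proj)
  also have "(\<lambda>y. y 0) ` (PiE UNIV A \<inter> \<Delta>) = (\<Inter>n. A n)"
  proof
    show "(\<lambda>y. y 0) ` (PiE UNIV A \<inter> \<Delta>) \<subseteq> (\<Inter>n. A n)"
    proof safe
      fix y n assume "y \<in> PiE UNIV A" "y \<in> \<Delta>"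
      then have "y n = y 0" "y n \<in> A n" by (auto simp: \<Delta>_def)
      then show "y 0 \<in> A n" by simp
    qed
    show "(\<Inter>n. A n) \<subseteq> (\<lambda>y. y 0) ` (PiE UNIV A \<inter> \<Delta>)"
    proof
      fix x assume "x \<in> (\<Inter>n. A n)"
      then have "(\<lambda>_. x) \<in> PiE UNIV A \<inter> \<Delta>"
        using analytic_in_subset[OF assms(2)] by (auto simp: \<Delta>_def topspace_product_topology)
      then show "x \<in> (\<lambda>y. y 0) ` (PiE UNIV A \<inter> \<Delta>)"
        by (auto intro!: image_eqI[of _ _ "\<lambda>_. x"])
    qed
  qed
  finally show ?thesis .
qed

lemma open_cylinder: "open {z :: nat \<Rightarrow> nat. \<forall>j<n. z j = y j}"
proof -
  have "{z :: nat \<Rightarrow> nat. \<forall>j<n. z j = y j} = (\<Inter>j\<in>{..<n}. (\<lambda>z. z j) -` {y j})"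
    by auto
  also have "open \<dots>"
    by (intro open_INT ballI open_vimage continuous_on_product_coordinates open_discrete) auto
  finally show ?thesis .
qed

lemma open_contains_cylinder:
  fixes y :: "nat \<Rightarrow> nat"
  assumes "open S" "y \<in> S"
  obtains N where "{z. \<forall>j<N. z j = y j} \<subseteq> S"
proof -
  obtain X where X: "y \<in> PiE UNIV X" "finite {i. X i \<noteq> UNIV}" "PiE UNIV X \<subseteq> S"
    using product_topology_open_contains_basis[of "\<lambda>_. euclidean" UNIV S y] assms
    by (auto simp: open_fun_def)
  obtain N where N: "{i. X i \<noteq> UNIV} \<subseteq> {..<N}"
    using X(2) finite_nat_iff_bounded by blast
  have "{z. \<forall>j<N. z j = y j} \<subseteq> PiE UNIV X"
  proof
    fix z assume z: "z \<in> {z. \<forall>j<N. z j = y j}"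
    have "z i \<in> X i" for i
    proof (cases "i < N")
      case True
      then show ?thesis using z X(1) by auto
    next
      case False
      then have "X i = UNIV" using N by auto
      then show ?thesis by simp
    qed
    then show "z \<in> PiE UNIV X" by auto
  qed
  then have "{z. \<forall>j<N. z j = y j} \<subseteq> S" using X(3) by (rule subset_trans)
  then show thesis by (rule that)
qed

text \<open>
  With \<open>q\<close> an enumeration of a dense set, a sequence \<open>y\<close> codes the point that lies in all the balls of
  center \<open>q (y j)\<close> and radius \<open>2\<^bsup>-j\<^esup>\<close>. If all finite intersections of these balls are nonempty, completeness
  provides the point; this condition on \<open>y\<close> is closed, and every point has a code by density.
\<close>

lemma analytic_in_Polish:
  assumes "completely_metrizable_space T" "separable_space T"
  shows "analytic_in T (topspace T)"
proof -
  obtain M d where "Metric_space M d" and mc: "Metric_space.mcomplete M d"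
    and T: "T = Metric_space.mtopology M d"
    using assms(1) unfolding completely_metrizable_space_def by blast
  then interpret Metric_space M d by simp
  obtain D where D: "countable D" "D \<subseteq> M" "mtopology closure_of D = M"
    using assms(2) unfolding separable_space_def T by auto
  show ?thesis
  proof (cases "M = {}")
    case True
    then have "topspace T = {}" by (metis T topspace_mtopology)
    then show ?thesis by (simp add: analytic_in_empty)
  next
    case False
    then have "D \<noteq> {}" using D(3) by auto
    define q where "q = from_nat_into D"
    have q: "q n \<in> M" for n
      using from_nat_into[OF \<open>D \<noteq> {}\<close>] D(2) by (auto simp: q_def)
    have dense: "\<exists>n. d (q n) x \<le> e" if "x \<in> M" "e > 0" for x e
    proof -
      have "\<exists>y\<in>D. y \<in> mball x e"
        using that D(3) by (auto simp: metric_closure_of)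
      then obtain y where "y \<in> D" "d x y < e" by auto
      moreover from \<open>y \<in> D\<close> obtain n where "y = q n"
        using from_nat_into_surj[OF D(1)] by (auto simp: q_def)
      ultimately show ?thesis by (auto intro!: exI[of _ n] simp: commute)
    qed
    define K where "K y n = (\<Inter>j\<in>{..n}. mcball (q (y j)) (1/2^j))" for y :: "nat \<Rightarrow> nat" and n :: nat
    define F where "F = {y. \<forall>n. K y n \<noteq> {}}"
    have "closed F"
    proof -
      have "open {y. K y n = {}}" for n
      proof (subst open_subopen, safe)
        fix y assume y: "K y n = {}"
        have "K z n = K y n" if "\<forall>j<Suc n. z j = y j" for z
          using that unfolding K_def by (intro INF_cong) auto
        then have "{z. \<forall>j<Suc n. z j = y j} \<subseteq> {y. K y n = {}}"
          using y by blast
        then show "\<exists>U. open U \<and> y \<in> U \<and> U \<subseteq> {y. K y n = {}}"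
          by (intro exI[of _ "{z. \<forall>j<Suc n. z j = y j}"] conjI open_cylinder) auto
      qed
      then have "closed (\<Inter>n. - {y. K y n = {}})"
        by (intro closed_INT ballI closed_Compl) auto
      also have "(\<Inter>n. - {y. K y n = {}}) = F"
        by (auto simp: F_def)
      finally show ?thesis .
    qed
    have "\<exists>l. l \<in> M \<and> \<Inter> (range (K y)) = {l}" if "y \<in> F" for y
    proof (rule mcomplete_nest_sing[THEN iffD1, rule_format, OF mc], intro conjI allI impI)
      show "closedin mtopology (K y n)" for n
        unfolding K_def by (intro closedin_INT) auto
      show "K y n \<noteq> {}" for n using that by (simp add: F_def)
      show "decseq (K y)" unfolding K_def decseq_def by (intro allI impI INF_superset_mono) auto
      fix e :: real assume "e > 0"
      then obtain n where "(1/2) ^ n < e"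
        using real_arch_pow_inv[of e "1/2"] by auto
      then have "K y n \<subseteq> mcball (q (y n)) e"
        by (auto simp: K_def power_divide intro: order_trans)
      then show "\<exists>n a. K y n \<subseteq> mcball a e" by blast
    qed
    then obtain l where l: "\<And>y. y \<in> F \<Longrightarrow> l y \<in> M \<and> \<Inter> (range (K y)) = {l y}"
      by metis
    have lK: "l y \<in> mcball (q (y n)) (1/2^n)" if "y \<in> F" for y n
    proof -
      have "l y \<in> K y n" using l[OF that] by blast
      then show ?thesis by (auto simp: K_def)
    qed
    have "continuous_map (top_of_set F) T l"
      unfolding T continuous_map_to_metric
    proof (intro ballI allI impI)
      fix y e assume y: "y \<in> topspace (top_of_set F)" and "(e :: real) > 0"
      then obtain n where n: "(1/2) ^ n < e / 2"
        using real_arch_pow_inv[of "e/2" "1/2"] by auto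
      let ?U = "F \<inter> {z. \<forall>j<Suc n. z j = y j}"
      have "l z \<in> mball (l y) e" if z: "z \<in> ?U" for z
      proof -
        have "z n = y n" using z by auto
        then have "d (q (y n)) (l z) \<le> 1/2^n" "d (q (y n)) (l y) \<le> 1/2^n"
          using lK[of z n] lK[of y n] z y by auto
        moreover have "d (l y) (l z) \<le> d (q (y n)) (l y) + d (q (y n)) (l z)"
          using triangle[of "l y" "q (y n)" "l z"] l z y q commute by auto
        ultimately show ?thesis
          using n l z y by (auto simp: power_divide)
      qed
      then show "\<exists>U. openin (top_of_set F) U \<and> y \<in> U \<and> (\<forall>z\<in>U. l z \<in> mball (l y) e)"
        using y by (intro exI[of _ ?U] conjI openin_open_Int open_cylinder) auto
    qed
    moreover have "l ` F = M"
    proof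
      show "l ` F \<subseteq> M" using l by auto
      show "M \<subseteq> l ` F"
      proof
        fix x assume x: "x \<in> M"
        have "\<exists>n. d (q n) x \<le> 1/2^j" for j :: nat
          using dense[OF x] by simp
        then obtain y where y: "\<And>j :: nat. d (q (y j)) x \<le> 1/2^j"
          by metis
        have xK: "x \<in> K y n" for n
          using y q x by (auto simp: K_def)
        then have "y \<in> F" by (auto simp: F_def)
        have "x \<in> \<Inter> (range (K y))" using xK by blast
        with l[OF \<open>y \<in> F\<close>] have "l y = x" by simp
        with \<open>y \<in> F\<close> show "x \<in> l ` F" by blast
      qed
    qed
    ultimately show ?thesis
      unfolding analytic_in_def using \<open>closed F\<close> T by auto
  qed
qed

lemma analytic_in_closedin:
  assumes "analytic_in T (topspace T)" "closedin T C"
  shows "analytic_in T C"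
  using analytic_in_Int_closedin[OF assms] closedin_subset[OF assms(2)]
  by (simp add: inf.absorb2)

lemma analytic_in_openin:
  assumes "metrizable_space T" "analytic_in T (topspace T)" "openin T U"
  shows "analytic_in T U"
proof -
  obtain C :: "nat \<Rightarrow> 'a set" where "\<And>n. closedin T (C n)" "U = (\<Union>n. C n)"
    using open_imp_fsigma_in[OF assms(1,3)] unfolding fsigma_in_ascending by blast
  then show ?thesis
    using analytic_in_UN_nat[of T C] analytic_in_closedin[OF assms(2)] by simp
qed

text \<open>
  The sets that are analytic together with their complements form a \<open>\<sigma>\<close>-algebra.
\<close>

lemma analytic_in_sigma_sets:
  assumes "Hausdorff_space T" "analytic_in T (topspace T)"
    and gen: "\<And>G. G \<in> \<G> \<Longrightarrow> G \<subseteq> topspace T \<and> analytic_in T G \<and> analytic_in T (topspace T - G)"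
    and "A \<in> sigma_sets (topspace T) \<G>"
  shows "A \<subseteq> topspace T \<and> analytic_in T A \<and> analytic_in T (topspace T - A)"
  using assms(4)
proof induction
  case (Basic G)
  then show ?case by (rule gen)
next
  case Empty
  then show ?case using assms(2) by (simp add: analytic_in_empty)
next
  case (Compl A)
  then show ?case by (simp add: double_diff)
next
  case (Union A)
  have "topspace T - (\<Union>n. A n) = (\<Inter>n. topspace T - A n)"
    by auto
  moreover have "analytic_in T (\<Inter>n. topspace T - A n)"
    using Union.IH by (intro analytic_in_INT_nat assms(1)) blast
  moreover have "analytic_in T (\<Union>n. A n)"
    using Union.IH by (intro analytic_in_UN_nat) blast
  ultimately show ?case
    using Union.IH by auto
qed

section \<open>Separation and Borel choice in standard Borel spaces\<close>

text \<open>
  A standard Borel space with a chosen Polish topology. Analytic sets always refer to this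
  topology, so that they can be combined.
\<close>

locale polish_borel =
  fixes M :: "'a measure" and T :: "'a topology"
  assumes topspace_eq: "topspace T = space M"
    and completely_metrizable: "completely_metrizable_space T"
    and separable: "separable_space T"
    and sets_eq: "sets M = sigma_sets (space M) {U. openin T U}"
begin

lemma metrizable: "metrizable_space T"
  by (rule completely_metrizable_imp_metrizable_space[OF completely_metrizable])

lemma Hausdorff: "Hausdorff_space T"
  by (rule metrizable_imp_Hausdorff_space[OF metrizable])

lemma analytic_topspace: "analytic_in T (topspace T)"
  by (rule analytic_in_Polish[OF completely_metrizable separable])

lemma analytic_space: "analytic_in T (space M)"
  using analytic_topspace by (simp add: topspace_eq)

lemma openin_sets: "openin T U \<Longrightarrow> U \<in> sets M"
  by (auto simp: sets_eq)

lemma analytic_sets: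
  assumes "A \<in> sets M"
  shows "analytic_in T A"
proof -
  have "A \<in> sigma_sets (topspace T) {U. openin T U}"
    using assms by (simp add: sets_eq topspace_eq)
  moreover have "U \<subseteq> topspace T \<and> analytic_in T U \<and> analytic_in T (topspace T - U)"
    if "U \<in> {U. openin T U}" for U
    using that openin_subset[of T U]
    by (auto intro: analytic_in_openin[OF metrizable] analytic_in_closedin analytic_topspace)
  ultimately show ?thesis
    using analytic_in_sigma_sets[OF Hausdorff analytic_topspace] by blast
qed

lemma analytic_sets_PiM:
  fixes I :: "nat set"
  assumes "R \<in> sets (\<Pi>\<^sub>M i\<in>I. M)"
  shows "analytic_in (product_topology (\<lambda>_. T) I) R"
proof -
  let ?P = "product_topology (\<lambda>_. T) I"
  let ?G = "{{f \<in> \<Pi>\<^sub>E i\<in>I. space M. f i \<in> A} | i A. i \<in> I \<and> A \<in> sets M}"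
  have top: "topspace ?P = (\<Pi>\<^sub>E i\<in>I. space M)"
    by (simp add: topspace_eq)
  have an: "analytic_in ?P {f \<in> \<Pi>\<^sub>E i\<in>I. space M. f i \<in> A}" if "i \<in> I" "A \<in> sets M" for i A
  proof -
    have "analytic_in ?P (PiE I (\<lambda>j. if j = i then A else space M))"
      using that by (intro analytic_in_PiE) (auto intro: analytic_sets analytic_space)
    also have "PiE I (\<lambda>j. if j = i then A else space M) = {f \<in> \<Pi>\<^sub>E i\<in>I. space M. f i \<in> A}"
      using that(1) sets.sets_into_space[OF that(2)]
      by (auto simp: PiE_iff Ball_def dest: extensional_arb) (metis subsetD)+
    finally show ?thesis .
  qed
  have "G \<subseteq> topspace ?P \<and> analytic_in ?P G \<and> analytic_in ?P (topspace ?P - G)" if G: "G \<in> ?G" for G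
  proof -
    obtain i A where iA: "i \<in> I" "A \<in> sets M" "G = {f \<in> \<Pi>\<^sub>E i\<in>I. space M. f i \<in> A}"
      using G by blast
    have "topspace ?P - G = {f \<in> \<Pi>\<^sub>E i\<in>I. space M. f i \<in> space M - A}"
      using iA unfolding top by (auto simp: PiE_iff dest: extensional_arb)
    then show ?thesis
      using an[of i A] an[of i "space M - A"] iA unfolding top by auto
  qed
  moreover have "R \<in> sigma_sets (topspace ?P) ?G"
    using assms unfolding sets_PiM_single top .
  moreover have "Hausdorff_space ?P"
    using Hausdorff by (simp add: Hausdorff_space_product_topology)
  moreover have "analytic_in ?P (topspace ?P)"
    unfolding top by (intro analytic_in_PiE analytic_space)
  ultimately show ?thesis
    using analytic_in_sigma_sets[of ?P ?G R] by blast
qed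

lemma analytic_projection:
  fixes I :: "nat set"
  assumes "R \<in> sets (\<Pi>\<^sub>M i\<in>I. M)" "i \<in> I"
  shows "analytic_in T ((\<lambda>y. y i) ` R)"
proof (rule analytic_in_image)
  show "analytic_in (product_topology (\<lambda>_. T) I) R"
    by (rule analytic_sets_PiM[OF assms(1)])
  show "continuous_map (product_topology (\<lambda>_. T) I) T (\<lambda>y. y i)"
    using continuous_map_product_projection[OF assms(2), of "\<lambda>_. T"] .
qed

text \<open>
  Suppose that no Borel sets separate the \<open>A n\<close>. Code points of all the \<open>A n\<close> by the rows of one matrix
  \<open>y : \<nat> \<rightarrow> \<nat>\<close>, and let \<open>cell y t n\<close> be the part of \<open>A n\<close> coded by rows that agree with the first \<open>t\<close> entries of
  \<open>y\<close>. Prescribing one more entry splits one of the cells into countably many pieces, and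
  separations for all the pieces combine to one for the union; hence some value of the entry keeps the
  cells inseparable. This yields a matrix \<open>w\<close> all of whose cells are inseparable. But its rows code
  points of the sets \<open>A n\<close>, two of which differ as the \<open>A n\<close> have no common point; by continuity the
  corresponding cells end up in disjoint open sets, which separate them.
\<close>

lemma novikov_separation:
  fixes A :: "nat \<Rightarrow> 'a set"
  assumes an: "\<And>n. analytic_in T (A n)" and disj: "(\<Inter>n. A n) = {}"
  shows "\<exists>C. (\<forall>n. A n \<subseteq> C n \<and> C n \<in> sets M) \<and> (\<Inter>n. C n) = {}"
proof (rule ccontr)
  define sep where "sep D \<longleftrightarrow> (\<exists>C. (\<forall>n. D n \<subseteq> C n \<and> C n \<in> sets M) \<and> (\<Inter>n. C n) = {})"
    for D :: "nat \<Rightarrow> 'a set"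
  assume "\<not> ?thesis"
  then have nsep: "\<not> sep A" by (simp add: sep_def)
  have "\<forall>n. \<exists>F f. closed (F :: (nat \<Rightarrow> nat) set) \<and> continuous_map (top_of_set F) T f \<and> f ` F = A n"
    using an unfolding analytic_in_def by blast
  then obtain F f where F: "\<And>n. closed (F n :: (nat \<Rightarrow> nat) set)"
    and f: "\<And>n. continuous_map (top_of_set (F n)) T (f n)"
    and im: "\<And>n. f n ` F n = A n"
    by metis
  define cell where "cell y t n =
      f n ` {z \<in> F n. \<forall>j. prod_encode (n, j) < t \<longrightarrow> z j = y (prod_encode (n, j))}"
    for y :: "nat \<Rightarrow> nat" and t n
  have cell_space: "cell y t n \<subseteq> space M" for y t n
  proof -
    have "cell y t n \<subseteq> A n" unfolding cell_def im[symmetric] by blast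
    also have "\<dots> \<subseteq> space M" using analytic_in_subset[OF an] by (simp add: topspace_eq)
    finally show ?thesis .
  qed
  have step: "\<exists>i. \<not> sep (cell (y(t := i)) (Suc t))" if "\<not> sep (cell y t)" for y t
  proof (rule ccontr)
    assume "\<not> ?thesis"
    then have "\<forall>i. \<exists>C. (\<forall>n. cell (y(t := i)) (Suc t) n \<subseteq> C n \<and> C n \<in> sets M) \<and> (\<Inter>n. C n) = {}"
      by (simp add: sep_def)
    then obtain C where C: "\<And>i n. cell (y(t := i)) (Suc t) n \<subseteq> C i n"
      and Cs: "\<And>i n. C i n \<in> sets M" and Cd: "\<And>i. (\<Inter>n. C i n) = {}"
      by metis
    \<comment> \<open>Entry \<open>t\<close> of the matrix belongs to row \<open>n0\<close>, so only the cell of \<open>A n0\<close> is split.\<close>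
    obtain n0 j0 where t: "t = prod_encode (n0, j0)"
      by (metis prod_decode_inverse surj_pair)
    define C' where "C' n = (if n = n0 then (\<Union>i. C i n) else (\<Inter>i. C i n))" for n
    have "cell y t n \<subseteq> C' n" for n
    proof (cases "n = n0")
      case True
      have "cell y t n0 \<subseteq> (\<Union>i. cell (y(t := i)) (Suc t) n0)"
      proof
        fix x assume "x \<in> cell y t n0"
        then obtain z where z: "x = f n0 z" "z \<in> F n0"
            "\<And>j. prod_encode (n0, j) < t \<Longrightarrow> z j = y (prod_encode (n0, j))"
          by (auto simp: cell_def)
        have "z j = (y(t := z j0)) (prod_encode (n0, j))" if "prod_encode (n0, j) < Suc t" for j
          using that z(3)[of j] by (auto simp: t less_Suc_eq)
        then have "x \<in> cell (y(t := z j0)) (Suc t) n0"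
          using z(1,2) unfolding cell_def by blast
        then show "x \<in> (\<Union>i. cell (y(t := i)) (Suc t) n0)" by blast
      qed
      also have "\<dots> \<subseteq> (\<Union>i. C i n0)" using C by blast
      finally show ?thesis by (simp add: C'_def True)
    next
      case False
      have "cell (y(t := i)) (Suc t) n = cell y t n" for i
        using False unfolding cell_def by (auto simp: t less_Suc_eq)
      then have "cell y t n \<subseteq> C i n" for i using C by metis
      then show ?thesis using False by (auto simp: C'_def)
    qed
    moreover have "C' n \<in> sets M" for n
      using Cs by (auto simp: C'_def)
    moreover have "(\<Inter>n. C' n) = {}"
    proof (rule equals0I)
      fix x assume x: "x \<in> (\<Inter>n. C' n)"
      then have "x \<in> C' n0" by blast
      then obtain i where i: "x \<in> C i n0" by (auto simp: C'_def)
      have "x \<in> C i n" for n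
      proof (cases "n = n0")
        case False
        moreover have "x \<in> C' n" using x by blast
        ultimately show ?thesis by (auto simp: C'_def)
      qed (use i in simp)
      then show False using Cd by blast
    qed
    ultimately show False using that unfolding sep_def by blast
  qed
  have "\<exists>Y. \<forall>t. \<not> sep (cell (Y t) t) \<and> (\<exists>i. Y (Suc t) = (Y t)(t := i))"
  proof (rule dependent_nat_choice)
    have "cell (\<lambda>_. 0) 0 = A" by (auto simp: cell_def im)
    then show "\<exists>y. \<not> sep (cell y 0)" using nsep by metis
  qed (use step in blast)
  then obtain Y where Y: "\<And>t. \<not> sep (cell (Y t) t)" "\<And>t. \<exists>i. Y (Suc t) = (Y t)(t := i)"
    by blast
  define w where "w t = Y (Suc t) t" for t
  have Yw: "Y t s = w s" if "s < t" for s t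
    using that
  proof (induction t)
    case (Suc t)
    then show ?case using Y(2)[of t] by (cases "s = t") (auto simp: w_def)
  qed simp
  have "cell (Y t) t = cell w t" for t
    unfolding cell_def by (intro ext) (auto simp: Yw)
  then have nsep_w: "\<not> sep (cell w t)" for t using Y(1) by metis
  define row where "row n = (\<lambda>j. w (prod_encode (n, j)))" for n
  have small: "\<exists>t. \<forall>t'\<ge>t. cell w t' n \<subseteq> f n ` (F n \<inter> S)" if "open S" "row n \<in> S" for n S
  proof -
    obtain N where N: "{z. \<forall>j<N. z j = row n j} \<subseteq> S"
      by (rule open_contains_cylinder[OF \<open>open S\<close> \<open>row n \<in> S\<close>])
    define t where "t = Suc (\<Sum>j<N. prod_encode (n, j))"
    have "prod_encode (n, j) < t'" if "t \<le> t'" "j < N" for j t'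
      using member_le_sum[of j "{..<N}" "\<lambda>j. prod_encode (n, j)"] that by (simp add: t_def)
    then have "cell w t' n \<subseteq> f n ` (F n \<inter> S)" if "t \<le> t'" for t'
      using that N unfolding cell_def row_def by (intro image_mono) blast
    then show ?thesis by blast
  qed
  \<comment> \<open>A row outside the closed set \<open>F n\<close> would make the cell empty, hence separable.\<close>
  have rowF: "row n \<in> F n" for n
  proof (rule ccontr)
    assume "row n \<notin> F n"
    then obtain t where "cell w t n \<subseteq> f n ` (F n \<inter> - F n)"
      using small[of "- F n" n] F by (auto simp: closed_def)
    then have "cell w t n = {}" by auto
    then have "sep (cell w t)"
      unfolding sep_def using cell_space
      by (intro exI[of _ "\<lambda>m. if m = n then {} else space M"]) (auto split: if_splits)
    then show False using nsep_w by blast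
  qed
  have near: "\<exists>t. \<forall>t'\<ge>t. cell w t' n \<subseteq> U" if "openin T U" "f n (row n) \<in> U" for n U
  proof -
    have "openin (top_of_set (F n)) {z \<in> topspace (top_of_set (F n)). f n z \<in> U}"
      by (rule openin_continuous_map_preimage[OF f that(1)])
    then obtain S where S: "open S" "{z \<in> F n. f n z \<in> U} = F n \<inter> S"
      by (auto simp: openin_open)
    then have "row n \<in> S" using rowF that(2) by blast
    moreover have "f n ` (F n \<inter> S) \<subseteq> U" using S(2) by blast
    ultimately show ?thesis using small[OF S(1)] by (meson subset_trans)
  qed
  have fA: "f n (row n) \<in> A n" for n using rowF im by blast
  have "\<exists>i. f i (row i) \<noteq> f 0 (row 0)"
  proof (rule ccontr)
    assume "\<not> ?thesis"
    then have "f 0 (row 0) \<in> (\<Inter>n. A n)" using fA by (metis INT_I)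
    then show False using disj by simp
  qed
  then obtain i where i: "f i (row i) \<noteq> f 0 (row 0)" by blast
  moreover have "f n (row n) \<in> topspace T" for n
    using fA analytic_in_subset[OF an] by blast
  ultimately obtain U V where UV: "openin T U" "openin T V" "f i (row i) \<in> U" "f 0 (row 0) \<in> V" "disjnt U V"
    using Hausdorff unfolding Hausdorff_space_def by metis
  obtain t1 t2 where "\<forall>t'\<ge>t1. cell w t' i \<subseteq> U" "\<forall>t'\<ge>t2. cell w t' 0 \<subseteq> V"
    using near[OF UV(1,3)] near[OF UV(2,4)] by blast
  then have t: "cell w (max t1 t2) i \<subseteq> U" "cell w (max t1 t2) 0 \<subseteq> V" by auto
  have "i \<noteq> 0" using i by metis
  have "sep (cell w (max t1 t2))"
    unfolding sep_def
  proof (intro exI conjI allI)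
    let ?C = "\<lambda>n. if n = i then U else if n = 0 then V else space M"
    show "cell w (max t1 t2) n \<subseteq> ?C n" for n using t cell_space by auto
    show "?C n \<in> sets M" for n using UV openin_sets by auto
    have "?C i \<inter> ?C 0 = {}" using \<open>i \<noteq> 0\<close> UV(5) by (auto simp: disjnt_def)
    then show "(\<Inter>n. ?C n) = {}" by blast
  qed
  then show False using nsep_w by blast
qed

text \<open>
  The complements of the bad sets cover the space and are only coanalytic, so the least \<open>n\<close> that is not bad
  for \<open>x\<close> need not depend on \<open>x\<close> in a Borel way. It does after Borel enlargement of the bad sets.
\<close>

lemma measurable_choice:
  fixes bad :: "nat \<Rightarrow> 'a set"
  assumes an: "\<And>n. analytic_in T (bad n)" and ex: "\<And>x. x \<in> space M \<Longrightarrow> \<exists>n. x \<notin> bad n"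
  shows "\<exists>g \<in> measurable M (count_space UNIV). \<forall>x\<in>space M. x \<notin> bad (g x)"
proof -
  have "(\<Inter>n. bad n) = {}"
  proof (rule equals0I)
    fix x assume x: "x \<in> (\<Inter>n. bad n)"
    then have "x \<in> space M"
      using analytic_in_subset[OF an, of 0] topspace_eq by auto
    from ex[OF this] x show False by auto
  qed
  from novikov_separation[OF an this] obtain C
    where C: "(\<forall>n. bad n \<subseteq> C n \<and> C n \<in> sets M) \<and> (\<Inter>n. C n) = {}" ..
  then have [measurable]: "C n \<in> sets M" for n by simp
  define g where "g x = (LEAST n. x \<notin> C n)" for x
  have "g \<in> measurable M (count_space UNIV)"
    unfolding g_def by measurable
  moreover have "x \<notin> bad (g x)" if "x \<in> space M" for x
  proof -
    have "\<exists>n. x \<notin> C n" using C by auto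
    then have "x \<notin> C (g x)" unfolding g_def by (rule LeastI_ex)
    then show ?thesis using C by auto
  qed
  ultimately show ?thesis by blast
qed

text \<open>
  Finite sets are closed, so the countably many balls of radius \<open>1 / (b + 1)\<close> around the points of a
  countable dense set will do.
\<close>

lemma separating_sets:
  obtains U :: "nat \<Rightarrow> 'a set" where "\<And>n. U n \<in> sets M"
    "\<And>x N. x \<in> space M \<Longrightarrow> finite N \<Longrightarrow> x \<notin> N \<Longrightarrow> \<exists>n. x \<in> U n \<and> N \<inter> U n = {}"
proof -
  obtain X d where "Metric_space X d" and T: "T = Metric_space.mtopology X d"
    using completely_metrizable unfolding completely_metrizable_space_def by blast
  then interpret Metric_space X d by simp
  have X: "X = space M" using topspace_eq by (metis T topspace_mtopology)
  obtain D where D: "countable D" "D \<subseteq> X" "mtopology closure_of D = X"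
    using separable unfolding separable_space_def T by auto
  define q where "q = from_nat_into D"
  define U where "U n = (case prod_decode n of (a, b) \<Rightarrow> mball (q a) (1 / Suc b))" for n
  show thesis
  proof
    show "U n \<in> sets M" for n
      by (auto simp: U_def T split: prod.splits intro!: openin_sets)
    fix x N assume "x \<in> space M" and N: "finite N" "x \<notin> N"
    then have x: "x \<in> X" by (simp only: X)
    have "finite (N \<inter> X)" using N by simp
    then have "closedin mtopology (N \<inter> X)"
      using closedin_Hausdorff_finite[OF Hausdorff] X topspace_eq T by auto
    then have "openin mtopology (X - N)"
      using openin_diff[OF openin_topspace, of mtopology "N \<inter> X"] by (simp add: Diff_Int)
    then obtain r where r: "r > 0" "mball x r \<subseteq> X - N"
      using x N unfolding openin_mtopology by blast
    obtain b where b: "1 / Suc b < r / 2"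
      using r(1) nat_approx_posE[of "r/2"] by auto
    have "x \<in> mtopology closure_of D" using x D(3) by simp
    moreover have "0 < 1 / real (Suc b)" by simp
    ultimately have "\<exists>y\<in>D. y \<in> mball x (1 / Suc b)"
      unfolding metric_closure_of by blast
    then obtain y where y: "y \<in> D" "y \<in> mball x (1 / Suc b)" by blast
    obtain a where "q a = y"
      using from_nat_into_surj[OF D(1) y(1)] by (auto simp: q_def)
    with y have a: "q a \<in> mball x (1 / Suc b)" by simp
    have "U (prod_encode (a, b)) \<subseteq> mball x r"
    proof
      fix z assume "z \<in> U (prod_encode (a, b))"
      then have "q a \<in> X" "z \<in> X" "d (q a) z < 1 / Suc b" by (auto simp: U_def)
      then show "z \<in> mball x r"
        using triangle[of x "q a" z] a b x by auto
    qed
    moreover have "x \<in> U (prod_encode (a, b))" using a by (auto simp: U_def commute)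
    ultimately show "\<exists>n. x \<in> U n \<and> N \<inter> U n = {}" using r(2) by blast
  qed
qed

end

section \<open>Averaging over the colors of a point\<close>

text \<open>
  In the application, \<open>w B c\<close> counts the elements of \<open>B\<close> that are still possible after color \<open>c\<close> is chosen,
  and \<open>W B\<close> those possible before. The sum of \<open>w B c / W B\<close> over the at most \<open>d\<close> constraints \<open>B\<close> and the \<open>k\<close> colors \<open>c\<close>
  is at most \<open>d\<close>, so for some \<open>c\<close> the sum over \<open>B\<close> is at most \<open>d / k\<close>, and then so is each term.
\<close>

lemma exists_color_by_averaging:
  fixes w :: "'b \<Rightarrow> nat \<Rightarrow> nat"
  assumes "finite V" "card V \<le> d" "k > 0" and sum: "\<And>B. B \<in> V \<Longrightarrow> (\<Sum>c<k. w B c) = W B"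
  shows "\<exists>c<k. \<forall>B\<in>V. k * w B c \<le> d * W B"
proof (rule ccontr)
  assume "\<not> ?thesis"
  then have bad: "\<exists>B\<in>V. d * W B < k * w B c" if "c < k" for c
    using that by (auto simp: not_le)
  \<comment> \<open>Constraints with \<open>W B = 0\<close> cannot be violated any more; removing them makes the quotients meaningful.\<close>
  define V' where "V' = {B \<in> V. W B > 0}"
  have "finite V'" "card V' \<le> d"
    using assms(1,2) card_mono[of V V'] by (auto simp: V'_def)
  have "real d / k < (\<Sum>B\<in>V'. real (w B c) / W B)" if c: "c < k" for c
  proof -
    obtain B where B: "B \<in> V" "d * W B < k * w B c" using bad[OF c] by blast
    have "w B c \<le> W B"
      unfolding sum[OF B(1), symmetric] using c by (intro member_le_sum) auto
    with B(2) have "W B > 0" by (cases "W B") auto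
    have "real (d * W B) < real (k * w B c)" using B(2) by (simp only: of_nat_less_iff)
    then have "real d / k < real (w B c) / W B"
      using \<open>W B > 0\<close> \<open>k > 0\<close> by (simp add: field_simps)
    also have "\<dots> \<le> (\<Sum>B\<in>V'. real (w B c) / W B)"
      using \<open>W B > 0\<close> B(1) \<open>finite V'\<close>
      by (intro member_le_sum[of B V' "\<lambda>B. real (w B c) / W B"]) (auto simp: V'_def)
    finally show ?thesis .
  qed
  then have "(\<Sum>c<k. real d / k) < (\<Sum>c<k. \<Sum>B\<in>V'. real (w B c) / W B)"
    using \<open>k > 0\<close> by (intro sum_strict_mono) auto
  also have "\<dots> = (\<Sum>B\<in>V'. \<Sum>c<k. real (w B c) / W B)"
    by (rule sum.swap)
  also have "\<dots> = (\<Sum>B\<in>V'. 1)"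
  proof (rule sum.cong)
    fix B assume B: "B \<in> V'"
    have "(\<Sum>c<k. real (w B c) / W B) = real (\<Sum>c<k. w B c) / W B"
      by (simp add: sum_divide_distrib)
    also have "\<dots> = 1" using B sum[of B] by (simp add: V'_def)
    finally show "(\<Sum>c<k. real (w B c) / W B) = 1" .
  qed simp
  also have "\<dots> \<le> real d" using \<open>card V' \<le> d\<close> by simp
  finally show False using \<open>k > 0\<close> by simp
qed

section \<open>Constraints as tuples of points\<close>

text \<open>
  A set is measurable in \<open>finite_subsets Z\<close> exactly if its preimages under the enumerations
  \<open>z \<mapsto> z ` {..<n}\<close> are, so every map that lists its values measurably is measurable.
\<close>

lemma measurable_image_finite_subsets:
  fixes n :: nat
  assumes "\<And>j. j < n \<Longrightarrow> (\<lambda>x. g x j) \<in> measurable N Z"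
  shows "(\<lambda>x. g x ` {..<n}) \<in> measurable N (finite_subsets Z)"
proof (rule measurableI)
  show "g x ` {..<n} \<in> space (finite_subsets Z)" if "x \<in> space N" for x
    using measurable_space[OF assms that] by (simp add: space_finite_subsets image_subset_iff)
  fix A assume A: "A \<in> sets (finite_subsets Z)"
  let ?P = "\<Pi>\<^sub>M i\<in>{..<n}. Z"
  let ?r = "\<lambda>x. \<lambda>j\<in>{..<n}. g x j"
  have r: "?r \<in> measurable N ?P"
    using assms by (intro measurable_restrict) auto
  have "{z \<in> space ?P. z ` {..<n} \<in> A} \<in> sets ?P"
    using A by (simp add: sets_finite_subsets)
  from measurable_sets[OF r this]
  have "?r -` {z \<in> space ?P. z ` {..<n} \<in> A} \<inter> space N \<in> sets N" .
  also have "?r -` {z \<in> space ?P. z ` {..<n} \<in> A} \<inter> space N = (\<lambda>x. g x ` {..<n}) -` A \<inter> space N"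
  proof -
    have "?r x ` {..<n} = g x ` {..<n}" for x by (intro image_cong) auto
    then show ?thesis using measurable_space[OF r] by auto
  qed
  finally show "(\<lambda>x. g x ` {..<n}) -` A \<inter> space N \<in> sets N" .
qed

text \<open>
  The graph of the coloring that gives \<open>y j\<close> the color \<open>s j\<close>. Repetitions in \<open>y\<close> are allowed, in which
  case this need not be the graph of a function.
\<close>

definition tuple_graph :: "nat \<Rightarrow> (nat \<Rightarrow> 'a) \<Rightarrow> (nat \<Rightarrow> nat) \<Rightarrow> ('a \<times> nat) set" where
  "tuple_graph m y s = (\<lambda>j. (y j, s j)) ` {..<m}"

definition patterns :: "nat \<Rightarrow> nat \<Rightarrow> (nat \<Rightarrow> nat) set set" where
  "patterns k m = {S. S \<noteq> {} \<and> S \<subseteq> (\<Pi>\<^sub>E j\<in>{..<m}. {..<k})}"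

lemma finite_patterns: "finite (patterns k m)"
proof -
  have "finite (\<Pi>\<^sub>E j\<in>{..<m}. {..<k})" by (intro finite_PiE) auto
  then show ?thesis unfolding patterns_def by (auto intro: finite_subset[of _ "Pow _"])
qed

lemma finite_pattern:
  assumes "S \<in> patterns k m"
  shows "finite S"
proof (rule finite_subset)
  show "S \<subseteq> (\<Pi>\<^sub>E j\<in>{..<m}. {..<k})" using assms by (simp add: patterns_def)
qed (intro finite_PiE; simp)

text \<open>
  The number of violating colorings that are not ruled out yet. With \<open>q\<close> saying which values are still
  possible at each point, this is the numerator of the conditional probability that \<open>B\<close> is violated.
\<close>

definition compatible_count :: "('a \<rightharpoonup> nat) set \<Rightarrow> ('a \<Rightarrow> nat \<Rightarrow> bool) \<Rightarrow> nat" where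
  "compatible_count B q = card {p \<in> B. \<forall>z v. p z = Some v \<longrightarrow> q z v}"

lemma compatible_count_cong:
  assumes "\<And>z v. z \<in> constraint_dom B \<Longrightarrow> q z v \<longleftrightarrow> q' z v"
  shows "compatible_count B q = compatible_count B q'"
proof -
  have "p \<in> B \<Longrightarrow> p z = Some v \<Longrightarrow> q z v \<longleftrightarrow> q' z v" for p z v
    using assms[of z v] by (auto simp: constraint_dom_def)
  then show ?thesis
    unfolding compatible_count_def by (intro arg_cong[where f = card]) blast
qed

lemma inj_graph: "inj Map.graph"
proof (rule injI, rule ext)
  fix p p' :: "'a \<rightharpoonup> 'b" and z assume "Map.graph p = Map.graph p'"
  then have "(z, v) \<in> Map.graph p \<longleftrightarrow> (z, v) \<in> Map.graph p'" for v
    by simp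
  then have "p z = Some v \<longleftrightarrow> p' z = Some v" for v
    by (simp add: Map.graph_def)
  then show "p z = p' z" by (metis option.exhaust)
qed

text \<open>
  The right-hand side depends on \<open>y\<close> only through the finitely many conditions \<open>q (y j) v\<close>, so it is a
  Borel function of \<open>y\<close>. Different patterns give different elements of \<open>B\<close> even if \<open>y\<close> has repetitions,
  since the graphs in \<open>B\<close> are functions.
\<close>

lemma compatible_count_tuple:
  assumes "Map.graph ` B = tuple_graph m y ` S" "S \<in> patterns k m"
  shows "compatible_count B q = card {s \<in> S. \<forall>j<m. q (y j) (s j)}"
proof -
  let ?G = "{G \<in> Map.graph ` B. \<forall>(z, v)\<in>G. q z v}"
  have "compatible_count B q = card (Map.graph ` {p \<in> B. \<forall>z v. p z = Some v \<longrightarrow> q z v})"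
    unfolding compatible_count_def
    by (rule card_image[symmetric]) (rule inj_on_subset[OF inj_graph subset_UNIV])
  also have "Map.graph ` {p \<in> B. \<forall>z v. p z = Some v \<longrightarrow> q z v} = ?G"
    by (auto simp: Map.graph_def)
  also have "?G = tuple_graph m y ` {s \<in> S. \<forall>j<m. q (y j) (s j)}"
    unfolding assms(1) by (auto simp: tuple_graph_def)
  also have "card \<dots> = card {s \<in> S. \<forall>j<m. q (y j) (s j)}"
  proof (intro card_image inj_onI ext)
    fix s s' j
    assume s: "s \<in> {s \<in> S. \<forall>j<m. q (y j) (s j)}" "s' \<in> {s \<in> S. \<forall>j<m. q (y j) (s j)}"
      and eq: "tuple_graph m y s = tuple_graph m y s'"
    show "s j = s' j"
    proof (cases "j < m")
      case True
      have "tuple_graph m y s \<in> Map.graph ` B" using s assms(1) by blast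
      then obtain p where p: "tuple_graph m y s = Map.graph p" by blast
      have "(y j, s j) \<in> tuple_graph m y s" using True by (auto simp: tuple_graph_def)
      moreover have "(y j, s' j) \<in> tuple_graph m y s" unfolding eq using True by (auto simp: tuple_graph_def)
      ultimately show ?thesis unfolding p by (auto simp: Map.graph_def)
    next
      case False
      then have "s j = undefined" "s' j = undefined"
        using s assms(2) by (auto simp: patterns_def subset_iff PiE_iff extensional_def)
      then show ?thesis by simp
    qed
  qed
  finally show ?thesis .
qed

text \<open>
  The bounds on degree, order and probability enter only through these finiteness conditions and the
  inequality \<open>\<P>[B] \<cdot> d\<^bsup>|dom B|\<^esup> < 1\<close>, stated here without division.
\<close>

locale polish_borel_csp = polish_borel M T
  for M :: "'a measure" and T :: "'a topology" +
  fixes k d :: nat and \<B> :: "('a \<rightharpoonup> nat) set set"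
  assumes k_pos: "k > 0"
    and borel: "borel_csp M k \<B>"
    and finite_incident: "\<And>x. x \<in> space M \<Longrightarrow> finite {B \<in> \<B>. x \<in> constraint_dom B}"
    and card_incident: "\<And>x. x \<in> space M \<Longrightarrow> card {B \<in> \<B>. x \<in> constraint_dom B} \<le> d"
    and few_violations:
      "\<And>B. B \<in> \<B> \<Longrightarrow> card B * d ^ card (constraint_dom B) < k ^ card (constraint_dom B)"
begin

lemma constraint:
  assumes "B \<in> \<B>"
  shows "finite (constraint_dom B)" "constraint_dom B \<subseteq> space M"
    "B \<subseteq> partial_colorings (constraint_dom B) k"
proof -
  obtain D where D: "finite D" "D \<subseteq> space M" "B \<subseteq> partial_colorings D k"
    using assms borel by (auto simp: borel_csp_def is_csp_def is_constraint_def)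
  have "finite (constraint_dom B) \<and> constraint_dom B \<subseteq> space M \<and>
    B \<subseteq> partial_colorings (constraint_dom B) k"
  proof (cases "B = {}")
    case True
    then show ?thesis by (simp add: constraint_dom_def)
  next
    case False
    then show ?thesis using D constraint_dom_eq[OF D(3)] by simp
  qed
  then show "finite (constraint_dom B)" "constraint_dom B \<subseteq> space M"
    "B \<subseteq> partial_colorings (constraint_dom B) k" by blast+
qed

lemma finite_constraint:
  assumes "B \<in> \<B>"
  shows "finite B"
proof (rule finite_subset)
  show "B \<subseteq> {p. dom p = constraint_dom B \<and> ran p \<subseteq> {..<k}}"
    using constraint(3)[OF assms] by (simp add: partial_colorings_def)
  show "finite {p. dom p = constraint_dom B \<and> ran p \<subseteq> {..<k}}"
    using constraint(1)[OF assms] by (rule finite_set_of_finite_maps) simp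
qed

definition codes :: "nat \<Rightarrow> (nat \<Rightarrow> nat) set \<Rightarrow> (nat \<Rightarrow> 'a) set" where
  "codes m S = {y \<in> space (\<Pi>\<^sub>M i\<in>{..<m}. M). tuple_graph m y ` S \<in> (\<lambda>B. Map.graph ` B) ` \<B>}"

lemma codes_sets:
  assumes "S \<in> patterns k m"
  shows "codes m S \<in> sets (\<Pi>\<^sub>M i\<in>{..<m}. M)"
proof -
  let ?P = "\<Pi>\<^sub>M i\<in>{..<m}. M"
  let ?Z = "M \<Otimes>\<^sub>M count_space {..<k}"
  obtain e n where e: "bij_betw e {..<n :: nat} S"
    using ex_bij_betw_nat_finite[OF finite_pattern[OF assms]] by (auto simp: atLeast0LessThan)
  then have S: "S = e ` {..<n}" by (simp add: bij_betw_def)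
  have "(\<lambda>y. tuple_graph m y (e l)) \<in> measurable ?P (finite_subsets ?Z)" if "l < n" for l
    unfolding tuple_graph_def
  proof (rule measurable_image_finite_subsets)
    fix j assume j: "j < m"
    have "e l \<in> S" using that S by blast
    then have "e l j < k" using assms j by (auto simp: patterns_def)
    then show "(\<lambda>y. (y j, e l j)) \<in> measurable ?P ?Z"
      using j by (intro measurable_Pair measurable_component_singleton) auto
  qed
  then have "(\<lambda>y. (\<lambda>l. tuple_graph m y (e l)) ` {..<n}) \<in> measurable ?P (finite_subsets (finite_subsets ?Z))"
    by (rule measurable_image_finite_subsets)
  then have "(\<lambda>y. (\<lambda>l. tuple_graph m y (e l)) ` {..<n}) -` ((\<lambda>B. Map.graph ` B) ` \<B>) \<inter> space ?P \<in> sets ?P"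
    using borel by (auto simp: borel_csp_def intro: measurable_sets)
  also have "(\<lambda>y. (\<lambda>l. tuple_graph m y (e l)) ` {..<n}) -` ((\<lambda>B. Map.graph ` B) ` \<B>) \<inter> space ?P = codes m S"
    unfolding codes_def S by (auto simp: image_image)
  finally show ?thesis .
qed

lemma codes_dom:
  assumes "S \<noteq> {}" "Map.graph ` B = tuple_graph m y ` S"
  shows "constraint_dom B = y ` {..<m}"
proof -
  have "constraint_dom B = (\<Union>G\<in>Map.graph ` B. fst ` G)"
    by (force simp: constraint_dom_def Map.graph_def dom_def)
  also have "\<dots> = y ` {..<m}"
    unfolding assms(2) using assms(1) by (auto simp: tuple_graph_def image_image)
  finally show ?thesis .
qed

lemma constraint_code:
  assumes "B \<in> \<B>" "B \<noteq> {}"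
  obtains m S y where "S \<in> patterns k m" "y \<in> codes m S" "Map.graph ` B = tuple_graph m y ` S"
proof -
  let ?D = "constraint_dom B"
  obtain y' m where y': "bij_betw y' {..<m :: nat} ?D"
    using ex_bij_betw_nat_finite[OF constraint(1)[OF assms(1)]] by (auto simp: atLeast0LessThan)
  define y where "y = restrict y' {..<m}"
  have y: "y ` {..<m} = ?D" "inj_on y {..<m}"
    using y' by (auto simp: y_def bij_betw_def inj_on_def)
  define pat where "pat p = (\<lambda>j\<in>{..<m}. the (p (y j)))" for p :: "'a \<rightharpoonup> nat"
  have p: "Map.graph p = tuple_graph m y (pat p)" "pat p \<in> (\<Pi>\<^sub>E j\<in>{..<m}. {..<k})" if "p \<in> B" for p
  proof -
    have dom: "dom p = y ` {..<m}" and ran: "ran p \<subseteq> {..<k}"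
      using constraint(3)[OF assms(1)] that y(1) by (auto simp: partial_colorings_def)
    have some: "p (y j) = Some (pat p j)" if "j < m" for j
    proof -
      have "y j \<in> dom p" using that by (auto simp: dom)
      then show ?thesis using that by (auto simp: pat_def)
    qed
    show "Map.graph p = tuple_graph m y (pat p)"
    proof -
      have "Map.graph p = (\<lambda>z. (z, the (p z))) ` dom p"
        by (force simp: Map.graph_def)
      also have "\<dots> = tuple_graph m y (pat p)"
        unfolding dom tuple_graph_def image_image by (intro image_cong) (auto simp: pat_def)
      finally show ?thesis .
    qed
    have "pat p j < k" if "j < m" for j
      using some[OF that] ran by (auto simp: ran_def)
    then show "pat p \<in> (\<Pi>\<^sub>E j\<in>{..<m}. {..<k})" by (auto simp: pat_def)
  qed
  have eq: "Map.graph ` B = tuple_graph m y ` (pat ` B)"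
    unfolding image_image using p(1) by (intro image_cong) auto
  show thesis
  proof
    show "pat ` B \<in> patterns k m"
      using p(2) assms(2) by (auto simp: patterns_def)
    have "tuple_graph m y ` (pat ` B) \<in> (\<lambda>B. Map.graph ` B) ` \<B>"
      unfolding eq[symmetric] using assms(1) by blast
    moreover have "y \<in> space (\<Pi>\<^sub>M i\<in>{..<m}. M)"
      using y(1) constraint(2)[OF assms(1)] by (auto simp: space_PiM y_def)
    ultimately show "y \<in> codes m (pat ` B)"
      unfolding codes_def by blast
    show "Map.graph ` B = tuple_graph m y ` (pat ` B)" by (rule eq)
  qed
qed

text \<open>
  Quantification over the constraints around \<open>x\<close> turns into a countable union of projections: \<open>x\<close> is an entry
  of a tuple that codes the constraint.
\<close>

lemma analytic_exists_code:
  assumes "\<And>m S i. S \<in> patterns k m \<Longrightarrow> i < m \<Longrightarrow>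
     {y \<in> space (\<Pi>\<^sub>M i\<in>{..<m}. M). P m S i y} \<in> sets (\<Pi>\<^sub>M i\<in>{..<m}. M)"
  shows "analytic_in T {x. \<exists>m. \<exists>S\<in>patterns k m. \<exists>i<m. \<exists>y\<in>codes m S. P m S i y \<and> x = y i}"
proof -
  have "analytic_in T ((\<lambda>y. y i) ` {y \<in> codes m S. P m S i y})"
    if "S \<in> patterns k m" "i < m" for m S i
  proof (rule analytic_projection)
    have "{y \<in> codes m S. P m S i y} = codes m S \<inter> {y \<in> space (\<Pi>\<^sub>M i\<in>{..<m}. M). P m S i y}"
      by (auto simp: codes_def)
    then show "{y \<in> codes m S. P m S i y} \<in> sets (\<Pi>\<^sub>M i\<in>{..<m}. M)"
      using codes_sets[OF that(1)] assms[OF that] by simp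
  qed (use that in simp)
  then have "analytic_in T (\<Union>m. \<Union>S\<in>patterns k m. \<Union>i\<in>{..<m}. (\<lambda>y. y i) ` {y \<in> codes m S. P m S i y})"
    by (intro analytic_in_UN) (auto intro: countable_finite finite_patterns)
  also have "(\<Union>m. \<Union>S\<in>patterns k m. \<Union>i\<in>{..<m}. (\<lambda>y. y i) ` {y \<in> codes m S. P m S i y})
     = {x. \<exists>m. \<exists>S\<in>patterns k m. \<exists>i<m. \<exists>y\<in>codes m S. P m S i y \<and> x = y i}"
    by blast
  finally show ?thesis .
qed

section \<open>A countable Borel coloring injective on constraints\<close>

text \<open>
  Points with a common constraint are neighbors; every point has finitely many. A countable family of Borel sets
  \<open>U n\<close> separates points from finite sets, so each \<open>x\<close> lies in some \<open>U n\<close> without neighbors of \<open>x\<close>. A Borel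
  choice of such an \<open>n\<close> gives distinct values to neighbors: if \<open>h x = h z = n\<close>, then \<open>z \<in> U n\<close> is not a neighbor of \<open>x\<close>.
\<close>

lemma proper_coloring:
  "\<exists>h \<in> measurable M (count_space (UNIV :: nat set)). \<forall>B\<in>\<B>. inj_on h (constraint_dom B)"
proof -
  obtain U :: "nat \<Rightarrow> 'a set" where U: "\<And>n. U n \<in> sets M"
    and sep: "\<And>x N. x \<in> space M \<Longrightarrow> finite N \<Longrightarrow> x \<notin> N \<Longrightarrow> \<exists>n. x \<in> U n \<and> N \<inter> U n = {}"
    by (rule separating_sets) blast
  note [measurable] = U
  \<comment> \<open>The sets \<open>U l\<close> also express \<open>y i \<noteq> y j\<close> by countably many Borel conditions.\<close>
  define P where "P n m S i y \<longleftrightarrow> (\<exists>j<m. (\<exists>l. y i \<in> U l \<and> y j \<notin> U l) \<and> y j \<in> U n)"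
    for n m :: nat and S :: "(nat \<Rightarrow> nat) set" and i and y :: "nat \<Rightarrow> 'a"
  define crowded where
    "crowded n = {x. \<exists>m. \<exists>S\<in>patterns k m. \<exists>i<m. \<exists>y\<in>codes m S. P n m S i y \<and> x = y i}" for n
  have "analytic_in T (crowded n)" for n
    unfolding crowded_def
  proof (rule analytic_exists_code)
    fix m i :: nat and S :: "(nat \<Rightarrow> nat) set" assume i: "i < m"
    have "{y \<in> space (\<Pi>\<^sub>M i\<in>{..<m}. M). P n m S i y} =
       (\<Union>j\<in>{..<m}. \<Union>l. {y \<in> space (\<Pi>\<^sub>M i\<in>{..<m}. M). y i \<in> U l \<and> y j \<notin> U l \<and> y j \<in> U n})"
      by (auto simp: P_def)
    also have "\<dots> \<in> sets (\<Pi>\<^sub>M i\<in>{..<m}. M)"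
    proof (rule sets.finite_UN, simp, rule sets.countable_UN'', simp)
      fix j and l :: nat assume "j \<in> {..<m}"
      then have [measurable]: "(\<lambda>y. y j) \<in> measurable (\<Pi>\<^sub>M i\<in>{..<m}. M) M"
        "(\<lambda>y. y i) \<in> measurable (\<Pi>\<^sub>M i\<in>{..<m}. M) M"
        using i by (auto intro: measurable_component_singleton)
      show "{y \<in> space (\<Pi>\<^sub>M i\<in>{..<m}. M). y i \<in> U l \<and> y j \<notin> U l \<and> y j \<in> U n} \<in> sets (\<Pi>\<^sub>M i\<in>{..<m}. M)"
        by measurable
    qed
    finally show "{y \<in> space (\<Pi>\<^sub>M i\<in>{..<m}. M). P n m S i y} \<in> sets (\<Pi>\<^sub>M i\<in>{..<m}. M)" .
  qed
  then have an: "analytic_in T ((space M - U n) \<union> crowded n)" for n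
    using analytic_in_UN[of "{True, False}" T "\<lambda>b. if b then space M - U n else crowded n"]
      analytic_sets[of "space M - U n"] U by (simp add: Un_commute)
  have crowded_iff: "x \<in> crowded n \<longleftrightarrow> (\<exists>B\<in>\<B>. x \<in> constraint_dom B \<and> (\<exists>z\<in>constraint_dom B. z \<noteq> x \<and> z \<in> U n))" for x n
  proof
    assume "x \<in> crowded n"
    then obtain m S i y where S: "S \<in> patterns k m" and i: "i < m" and y: "y \<in> codes m S"
      and P: "P n m S i y" and x: "x = y i"
      unfolding crowded_def by blast
    obtain B where B: "B \<in> \<B>" "Map.graph ` B = tuple_graph m y ` S"
      using y by (auto simp: codes_def)
    have D: "constraint_dom B = y ` {..<m}"
      using codes_dom[OF _ B(2)] S by (simp add: patterns_def)
    obtain j where "j < m" "y j \<noteq> y i" "y j \<in> U n" using P unfolding P_def by metis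
    then show "\<exists>B\<in>\<B>. x \<in> constraint_dom B \<and> (\<exists>z\<in>constraint_dom B. z \<noteq> x \<and> z \<in> U n)"
      using B(1) i x unfolding D by (intro bexI[of _ B]) (auto simp: D)
  next
    assume "\<exists>B\<in>\<B>. x \<in> constraint_dom B \<and> (\<exists>z\<in>constraint_dom B. z \<noteq> x \<and> z \<in> U n)"
    then obtain B z where B: "B \<in> \<B>" "x \<in> constraint_dom B" "z \<in> constraint_dom B" "z \<noteq> x" "z \<in> U n"
      by blast
    then have "B \<noteq> {}" by (auto simp: constraint_dom_def)
    obtain m S y where S: "S \<in> patterns k m" and y: "y \<in> codes m S"
      and g: "Map.graph ` B = tuple_graph m y ` S"
      by (rule constraint_code[OF B(1) \<open>B \<noteq> {}\<close>])
    have D: "constraint_dom B = y ` {..<m}"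
      using codes_dom[OF _ g] S by (simp add: patterns_def)
    obtain i j where ij: "i < m" "x = y i" "j < m" "z = y j" using B(2,3) D by auto
    obtain l where "x \<in> U l" "{z} \<inter> U l = {}"
      using sep[of x "{z}"] B(1,2,4) constraint(2)[OF B(1)] by auto
    then have "P n m S i y" using ij B(5) by (auto simp: P_def)
    then show "x \<in> crowded n" unfolding crowded_def using S y ij by blast
  qed
  have "\<exists>n. x \<notin> (space M - U n) \<union> crowded n" if x: "x \<in> space M" for x
  proof -
    let ?N = "(\<Union>B\<in>{B \<in> \<B>. x \<in> constraint_dom B}. constraint_dom B) - {x}"
    have "finite ?N"
      using finite_incident[OF x] constraint(1) by auto
    then obtain n where "x \<in> U n" "?N \<inter> U n = {}"
      using sep[OF x, of ?N] by auto
    then have "x \<notin> (space M - U n) \<union> crowded n"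
      unfolding Un_iff crowded_iff by blast
    then show ?thesis ..
  qed
  from measurable_choice[OF an this] obtain h
    where h: "h \<in> measurable M (count_space UNIV)"
      "\<forall>x\<in>space M. x \<notin> (space M - U (h x)) \<union> crowded (h x)" by blast
  have "inj_on h (constraint_dom B)" if B: "B \<in> \<B>" for B
  proof (rule inj_onI, rule ccontr)
    fix x z assume xz: "x \<in> constraint_dom B" "z \<in> constraint_dom B" "h x = h z" "x \<noteq> z"
    then have "x \<in> space M" "z \<in> space M" using constraint(2)[OF B] by auto
    then have "x \<notin> crowded (h x)" "z \<in> U (h x)" using h(2) xz(3) by auto
    moreover have "x \<in> crowded (h x)"
      unfolding crowded_iff using B xz(1,2,4) \<open>z \<in> U (h x)\<close> by (intro bexI[of _ B] conjI bexI[of _ z]) auto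
    ultimately show False by simp
  qed
  with h(1) show ?thesis by blast
qed

section \<open>Coloring in stages\<close>

text \<open>
  Every element of \<open>B\<close> assigns exactly one color to \<open>x\<close>.
\<close>

lemma sum_compatible_count:
  assumes B: "B \<in> \<B>" and x: "x \<in> constraint_dom B"
  shows "(\<Sum>c<k. compatible_count B (\<lambda>z v. q z v \<and> (z = x \<longrightarrow> v = c))) = compatible_count B q"
proof -
  let ?C = "{p \<in> B. \<forall>z v. p z = Some v \<longrightarrow> q z v}"
  let ?Cc = "\<lambda>c. {p \<in> B. \<forall>z v. p z = Some v \<longrightarrow> q z v \<and> (z = x \<longrightarrow> v = c)}"
  have val: "\<exists>c<k. p x = Some c" if "p \<in> B" for p
  proof -
    have "dom p = constraint_dom B" "ran p \<subseteq> {..<k}"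
      using constraint(3)[OF B] that by (auto simp: partial_colorings_def)
    then obtain c where "p x = Some c" using x by auto
    moreover from this have "c < k" using \<open>ran p \<subseteq> {..<k}\<close> by (auto simp: ran_def)
    ultimately show ?thesis by blast
  qed
  have "?C = (\<Union>c\<in>{..<k}. ?Cc c)"
  proof (intro equalityI subsetI)
    fix p assume p: "p \<in> ?C"
    then obtain c where "c < k" "p x = Some c" using val by blast
    then show "p \<in> (\<Union>c\<in>{..<k}. ?Cc c)" using p by (intro UN_I[of c]) auto
  qed auto
  moreover have "card (\<Union>c\<in>{..<k}. ?Cc c) = (\<Sum>c<k. card (?Cc c))"
  proof (rule card_UN_disjoint)
    show "\<forall>c\<in>{..<k}. finite (?Cc c)" using finite_constraint[OF B] by simp
    show "\<forall>c\<in>{..<k}. \<forall>c'\<in>{..<k}. c \<noteq> c' \<longrightarrow> ?Cc c \<inter> ?Cc c' = {}"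
    proof (intro ballI impI equals0I)
      fix c c' p assume "c \<noteq> c'" and p: "p \<in> ?Cc c \<inter> ?Cc c'"
      then obtain v where "p x = Some v" using val by blast
      then have "v = c" "v = c'" using p by auto
      with \<open>c \<noteq> c'\<close> show False by simp
    qed
  qed simp
  ultimately show ?thesis by (simp add: compatible_count_def)
qed

text \<open>
  The values that remain possible at \<open>z\<close> when \<open>f\<close> is binding for the points of stages before \<open>t\<close>.
\<close>

definition colored_before :: "('a \<Rightarrow> nat) \<Rightarrow> nat \<Rightarrow> ('a \<Rightarrow> nat) \<Rightarrow> 'a \<Rightarrow> nat \<Rightarrow> bool" where
  "colored_before h t f z v \<longleftrightarrow> (h z < t \<longrightarrow> v = f z)"

text \<open>
  One stage. The bad sets for the choice of \<open>g x\<close> consist of the points of stage \<open>t\<close> with a constraint whose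
  conditional probability grows by a factor greater than \<open>d\<close>. Declaring the values \<open>c \<ge> k\<close> bad for all points
  keeps \<open>g\<close> below \<open>k\<close>.
\<close>

lemma measurable_stage:
  assumes [measurable]: "h \<in> measurable M (count_space UNIV)" "f \<in> measurable M (count_space UNIV)"
    and inj: "\<And>B. B \<in> \<B> \<Longrightarrow> inj_on h (constraint_dom B)"
  shows "\<exists>g \<in> measurable M (count_space UNIV). \<forall>x\<in>space M. g x < k \<and>
    (h x = t \<longrightarrow> (\<forall>B\<in>\<B>. x \<in> constraint_dom B \<longrightarrow>
      k * compatible_count B (\<lambda>z v. colored_before h t f z v \<and> (z = x \<longrightarrow> v = g x))
        \<le> d * compatible_count B (colored_before h t f)))"
proof -
  let ?q = "colored_before h t f"
  \<comment> \<open>For the points of \<open>dom B\<close>, being in stage \<open>t\<close> is the same as being equal to \<open>x\<close>. The former condition does not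
    mention \<open>x\<close>, so it can be evaluated along a tuple.\<close>
  define q' where "q' c z v \<longleftrightarrow> colored_before h t f z v \<and> (h z = t \<longrightarrow> v = c)" for c z v
  define P where "P c m S i y \<longleftrightarrow> h (y i) = t \<and>
      d * card {s \<in> S. \<forall>j<m. ?q (y j) (s j)} < k * card {s \<in> S. \<forall>j<m. q' c (y j) (s j)}"
    for c m i :: nat and S :: "(nat \<Rightarrow> nat) set" and y :: "nat \<Rightarrow> 'a"
  define bad where "bad c = (if c < k
      then {x. \<exists>m. \<exists>S\<in>patterns k m. \<exists>i<m. \<exists>y\<in>codes m S. P c m S i y \<and> x = y i}
      else space M)" for c
  have "analytic_in T {x. \<exists>m. \<exists>S\<in>patterns k m. \<exists>i<m. \<exists>y\<in>codes m S. P c m S i y \<and> x = y i}" for c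
  proof (rule analytic_exists_code)
    fix m S i assume S: "S \<in> patterns k m" and i: "i < m"
    let ?M = "\<Pi>\<^sub>M i\<in>{..<m}. M"
    have [measurable]: "(\<lambda>y. h (y j)) \<in> measurable ?M (count_space UNIV)"
        "(\<lambda>y. f (y j)) \<in> measurable ?M (count_space UNIV)" if "j < m" for j
      using that by (auto intro!: measurable_compose[OF measurable_component_singleton] assms(1,2))
    have card: "card {s \<in> S. Q s} = (\<Sum>s\<in>S. if Q s then 1 else 0)" for Q
      using finite_pattern[OF S] by (simp add: sum.If_cases Int_def)
    have cards: "(\<lambda>y. card {s \<in> S. \<forall>j<m. r (y j) (s j)}) \<in> measurable ?M (count_space UNIV)"
      if r: "\<And>j v. j < m \<Longrightarrow> Measurable.pred ?M (\<lambda>y. r (y j) v)" for r :: "'a \<Rightarrow> nat \<Rightarrow> bool"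
    proof -
      have [measurable]: "Measurable.pred ?M (\<lambda>y. \<forall>j\<in>{..<m}. r (y j) (s j))" for s
        using r by (intro pred_intros_finite) auto
      show ?thesis
        unfolding card by (simp only: Ball_def[symmetric] lessThan_iff[symmetric]) measurable
    qed
    have [measurable]: "(\<lambda>y. card {s \<in> S. \<forall>j<m. ?q (y j) (s j)}) \<in> measurable ?M (count_space UNIV)"
    proof (rule cards)
      fix j v assume [simp]: "j < m"
      show "Measurable.pred ?M (\<lambda>y. ?q (y j) v)" unfolding colored_before_def by measurable
    qed
    have [measurable]: "(\<lambda>y. card {s \<in> S. \<forall>j<m. q' c (y j) (s j)}) \<in> measurable ?M (count_space UNIV)"
    proof (rule cards)
      fix j v assume [simp]: "j < m"
      show "Measurable.pred ?M (\<lambda>y. q' c (y j) v)" unfolding q'_def colored_before_def by measurable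
    qed
    show "{y \<in> space ?M. P c m S i y} \<in> sets ?M"
      unfolding P_def using i by measurable
  qed
  then have an: "analytic_in T (bad c)" for c
    by (simp add: bad_def analytic_space)
  have q'_eq: "compatible_count B (q' c) = compatible_count B (\<lambda>z v. ?q z v \<and> (z = x \<longrightarrow> v = c))"
    if "B \<in> \<B>" "x \<in> constraint_dom B" "h x = t" for B x c
  proof (rule compatible_count_cong)
    fix z v assume "z \<in> constraint_dom B"
    then have "h z = t \<longleftrightarrow> z = x" using inj[OF that(1)] that(2,3) by (auto dest: inj_onD)
    then show "q' c z v \<longleftrightarrow> ?q z v \<and> (z = x \<longrightarrow> v = c)" by (simp add: q'_def)
  qed
  have bad_iff: "x \<in> bad c \<longleftrightarrow> h x = t \<and> (\<exists>B\<in>\<B>. x \<in> constraint_dom B \<and>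
      d * compatible_count B ?q < k * compatible_count B (\<lambda>z v. ?q z v \<and> (z = x \<longrightarrow> v = c)))"
    if "c < k" for x c
  proof
    assume "x \<in> bad c"
    then obtain m S i y where S: "S \<in> patterns k m" and i: "i < m" and y: "y \<in> codes m S"
      and P: "P c m S i y" and x: "x = y i"
      using \<open>c < k\<close> unfolding bad_def by auto
    obtain B where B: "B \<in> \<B>" and g: "Map.graph ` B = tuple_graph m y ` S"
      using y by (auto simp: codes_def)
    have D: "constraint_dom B = y ` {..<m}"
      using codes_dom[OF _ g] S by (simp add: patterns_def)
    have xB: "x \<in> constraint_dom B" using D i x by auto
    have "h x = t" using P x by (simp add: P_def)
    moreover have "d * compatible_count B ?q < k * compatible_count B (q' c)"
      using P by (simp add: P_def compatible_count_tuple[OF g S])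
    ultimately show "h x = t \<and> (\<exists>B\<in>\<B>. x \<in> constraint_dom B \<and>
      d * compatible_count B ?q < k * compatible_count B (\<lambda>z v. ?q z v \<and> (z = x \<longrightarrow> v = c)))"
      using B xB q'_eq[OF B xB] by auto
  next
    assume "h x = t \<and> (\<exists>B\<in>\<B>. x \<in> constraint_dom B \<and>
      d * compatible_count B ?q < k * compatible_count B (\<lambda>z v. ?q z v \<and> (z = x \<longrightarrow> v = c)))"
    then obtain B where hx: "h x = t" and B: "B \<in> \<B>" and xB: "x \<in> constraint_dom B" and
      less: "d * compatible_count B ?q < k * compatible_count B (\<lambda>z v. ?q z v \<and> (z = x \<longrightarrow> v = c))"
      by blast
    have "B \<noteq> {}" using xB by (auto simp: constraint_dom_def)
    obtain m S y where S: "S \<in> patterns k m" and y: "y \<in> codes m S"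
      and g: "Map.graph ` B = tuple_graph m y ` S"
      by (rule constraint_code[OF B \<open>B \<noteq> {}\<close>])
    have D: "constraint_dom B = y ` {..<m}"
      using codes_dom[OF _ g] S by (simp add: patterns_def)
    obtain i where i: "i < m" "x = y i" using xB D by auto
    have "P c m S i y"
      using less hx i(2) unfolding q'_eq[OF B xB hx, symmetric]
      by (simp add: P_def compatible_count_tuple[OF g S])
    then show "x \<in> bad c" unfolding bad_def using S y i \<open>c < k\<close> by auto
  qed
  have "\<exists>c. x \<notin> bad c" if x: "x \<in> space M" for x
  proof -
    obtain c where "c < k" and c: "\<forall>B\<in>{B \<in> \<B>. x \<in> constraint_dom B}.
        k * compatible_count B (\<lambda>z v. ?q z v \<and> (z = x \<longrightarrow> v = c)) \<le> d * compatible_count B ?q"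
      using exists_color_by_averaging[OF finite_incident[OF x] card_incident[OF x] k_pos,
          of "\<lambda>B c. compatible_count B (\<lambda>z v. ?q z v \<and> (z = x \<longrightarrow> v = c))" "\<lambda>B. compatible_count B ?q"]
        sum_compatible_count by auto
    then have "x \<notin> bad c"
      unfolding bad_iff[OF \<open>c < k\<close>] by (auto simp: not_less)
    then show ?thesis ..
  qed
  from measurable_choice[OF an this] obtain g
    where g: "g \<in> measurable M (count_space UNIV)" "\<forall>x\<in>space M. x \<notin> bad (g x)" by blast
  have "g x < k" if "x \<in> space M" for x
    using g(2) that by (auto simp: bad_def split: if_splits)
  then show ?thesis
    using g bad_iff by (intro bexI[of _ g]) (auto simp: not_less)
qed

text \<open>
  Before stage \<open>t\<close>, if \<open>a\<close> points of \<open>dom B\<close> are colored, then the conditional probability of violating \<open>B\<close> is at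
  most \<open>\<P>[B] d\<^bsup>a\<^esup>\<close>; cleared of denominators, this is the invariant \<open>good\<close>. A point keeps the color of its own
  stage forever, so the stages converge pointwise, and on the finite set \<open>dom B\<close> the limit is reached.
\<close>

theorem measurable_solution:
  "\<exists>f \<in> measurable M (count_space {..<k}). is_solution (space M) k \<B> f"
proof -
  obtain h where h[measurable]: "h \<in> measurable M (count_space (UNIV :: nat set))"
    and inj: "\<And>B. B \<in> \<B> \<Longrightarrow> inj_on h (constraint_dom B)"
    using proper_coloring by blast
  define a where "a t B = card {z \<in> constraint_dom B. h z < t}" for t B
  define good where "good t f \<longleftrightarrow> f \<in> measurable M (count_space UNIV) \<and> (\<forall>x\<in>space M. f x < k) \<and>
    (\<forall>B\<in>\<B>. compatible_count B (colored_before h t f) * k ^ a t B \<le> card B * d ^ a t B)" for t f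
  have "\<exists>F. \<forall>t. good t (F t) \<and> (\<forall>x. h x \<noteq> t \<longrightarrow> F (Suc t) x = F t x)"
  proof (rule dependent_nat_choice)
    have "compatible_count B (colored_before h 0 (\<lambda>_. 0)) = card B" for B
      by (simp add: compatible_count_def colored_before_def)
    then show "\<exists>f. good 0 f"
      using k_pos by (intro exI[of _ "\<lambda>_. 0"]) (simp add: good_def a_def)
  next
    fix f t assume f: "good t f"
    then have [measurable]: "f \<in> measurable M (count_space UNIV)" by (simp add: good_def)
    obtain g where [measurable]: "g \<in> measurable M (count_space UNIV)"
      and g: "\<And>x. x \<in> space M \<Longrightarrow> g x < k"
      and step: "\<And>x B. \<lbrakk>x \<in> space M; h x = t; B \<in> \<B>; x \<in> constraint_dom B\<rbrakk> \<Longrightarrow>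
        k * compatible_count B (\<lambda>z v. colored_before h t f z v \<and> (z = x \<longrightarrow> v = g x))
          \<le> d * compatible_count B (colored_before h t f)"
      using measurable_stage[OF h _ inj, of f t] by auto
    define f' where "f' x = (if h x = t then g x else f x)" for x
    have "f' \<in> measurable M (count_space UNIV)" unfolding f'_def by measurable
    moreover have "f' x < k" if "x \<in> space M" for x
      using f g that by (simp add: good_def f'_def)
    moreover have "compatible_count B (colored_before h (Suc t) f') * k ^ a (Suc t) B
        \<le> card B * d ^ a (Suc t) B" if B: "B \<in> \<B>" for B
    proof (cases "\<exists>x\<in>constraint_dom B. h x = t")
      case False
      then have less: "h z < Suc t \<longleftrightarrow> h z < t" if "z \<in> constraint_dom B" for z
        using that by (auto simp: less_Suc_eq)
      then have "a (Suc t) B = a t B"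
        unfolding a_def by (intro arg_cong[where f = card]) auto
      moreover have "compatible_count B (colored_before h (Suc t) f') = compatible_count B (colored_before h t f)"
        using less False by (intro compatible_count_cong) (auto simp: colored_before_def f'_def)
      ultimately show ?thesis using f B by (simp add: good_def)
    next
      case True
      then obtain x where x: "x \<in> constraint_dom B" "h x = t" by blast
      have eq: "h z = t \<longleftrightarrow> z = x" if "z \<in> constraint_dom B" for z
        using inj[OF B] x that by (auto dest: inj_onD)
      have "{z \<in> constraint_dom B. h z < Suc t} = insert x {z \<in> constraint_dom B. h z < t}"
        using eq x by (auto simp: less_Suc_eq)
      then have a: "a (Suc t) B = Suc (a t B)"
        unfolding a_def using x constraint(1)[OF B] by simp
      have "compatible_count B (colored_before h (Suc t) f') =
          compatible_count B (\<lambda>z v. colored_before h t f z v \<and> (z = x \<longrightarrow> v = g x))"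
        using eq x by (intro compatible_count_cong) (auto simp: colored_before_def f'_def less_Suc_eq)
      then have "k * compatible_count B (colored_before h (Suc t) f')
          \<le> d * compatible_count B (colored_before h t f)"
        using step[of x B] x B constraint(2)[OF B] by auto
      then have "k * compatible_count B (colored_before h (Suc t) f') * k ^ a t B
          \<le> d * compatible_count B (colored_before h t f) * k ^ a t B"
        by (rule mult_le_mono1)
      also have "\<dots> = d * (compatible_count B (colored_before h t f) * k ^ a t B)" by simp
      also have "\<dots> \<le> d * (card B * d ^ a t B)"
        using f B by (intro mult_le_mono2) (simp add: good_def)
      finally show ?thesis by (simp add: a mult_ac)
    qed
    ultimately have "good (Suc t) f'" by (simp add: good_def)
    then show "\<exists>f'. good (Suc t) f' \<and> (\<forall>x. h x \<noteq> t \<longrightarrow> f' x = f x)"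
      by (intro exI[of _ f']) (simp add: f'_def)
  qed
  then obtain F where F: "\<And>t. good t (F t)" and F_Suc: "\<And>t x. h x \<noteq> t \<Longrightarrow> F (Suc t) x = F t x"
    by blast
  \<comment> \<open>The color of \<open>x\<close> is fixed during stage \<open>h x\<close>, hence present in the coloring after it.\<close>
  define f where "f x = F (Suc (h x)) x" for x
  have F_f: "F t x = f x" if "h x < t" for t x
    using that
  proof (induction t)
    case (Suc t)
    show ?case
    proof (cases "h x = t")
      case True
      then show ?thesis by (simp add: f_def)
    next
      case False
      then show ?thesis using Suc F_Suc[of x t] by simp
    qed
  qed simp
  have [measurable]: "F t \<in> measurable M (count_space UNIV)" for t
    using F by (simp add: good_def)
  have "f \<in> measurable M (count_space UNIV)"
    unfolding f_def by (rule measurable_compose_countable[where g = h]) measurable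
  moreover have fk: "f x < k" if "x \<in> space M" for x
    using F[of "Suc (h x)"] that by (simp add: good_def f_def)
  ultimately have "f \<in> measurable M (count_space {..<k})"
    by (subst measurable_count_space_eq2_countable) (auto intro: measurable_sets)
  moreover have "\<not> violates f B" if B: "B \<in> \<B>" for B
  proof
    assume "violates f B"
    define p where "p = (Some \<circ> f) |` constraint_dom B"
    have p: "p \<in> B" using \<open>violates f B\<close> by (simp add: violates_def p_def)
    have "finite (h ` constraint_dom B)" using constraint(1)[OF B] by simp
    then obtain t where t: "h ` constraint_dom B \<subseteq> {..<t}" using finite_nat_iff_bounded by blast
    have "{z \<in> constraint_dom B. h z < t} = constraint_dom B" using t by auto
    then have a: "a t B = card (constraint_dom B)" by (simp add: a_def)
    have "p z = Some v \<Longrightarrow> colored_before h t (F t) z v" for z v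
      using F_f[of z t] by (auto simp: p_def colored_before_def restrict_map_def split: if_splits)
    then have "{p} \<subseteq> {p \<in> B. \<forall>z v. p z = Some v \<longrightarrow> colored_before h t (F t) z v}"
      using p by blast
    then have "1 \<le> compatible_count B (colored_before h t (F t))"
      unfolding compatible_count_def using card_mono[of _ "{p}"] finite_constraint[OF B] by fastforce
    then have "k ^ card (constraint_dom B) \<le> compatible_count B (colored_before h t (F t)) * k ^ a t B"
      by (simp add: a)
    also have "\<dots> \<le> card B * d ^ a t B" using F[of t] B by (simp add: good_def)
    also have "\<dots> < k ^ card (constraint_dom B)" using few_violations[OF B] by (simp add: a)
    finally show False by simp
  qed
  ultimately show ?thesis using fk by (auto simp: is_solution_def)
qed

end

section \<open>The local lemma for Borel constraint satisfaction problems\<close>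

theorem corollary1p8:
  fixes M :: "'a measure" and k :: nat and \<B> :: "('a \<rightharpoonup> nat) set set"
  assumes "standard_borel M"
    and "k > 0"
    and "borel_csp M k \<B>"
    and "csp_vdeg (space M) \<B> < \<infinity>"
    and "csp_ord \<B> < \<infinity>"
    and "csp_prob k \<B> * of_nat (the_enat (csp_vdeg (space M) \<B>)) ^ the_enat (csp_ord \<B>) < 1"
  shows "\<exists>f \<in> measurable M (count_space {..<k}). is_solution (space M) k \<B> f"
proof -
  obtain T where T: "topspace T = space M" "completely_metrizable_space T" "separable_space T"
    "sets M = sigma_sets (space M) {U. openin T U}"
    using assms(1) by (auto simp: standard_borel_def)
  define d where "d = the_enat (csp_vdeg (space M) \<B>)"
  define r where "r = the_enat (csp_ord \<B>)"
  have d: "csp_vdeg (space M) \<B> = enat d" and r: "csp_ord \<B> = enat r"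
    using assms(4,5) by (auto simp: d_def r_def)
  have size_le: "finite S \<and> card S \<le> n" if "set_size S \<le> enat n" for S :: "'b set" and n
    using that by (auto simp: set_size_def split: if_splits)
  have incident: "finite {B \<in> \<B>. x \<in> constraint_dom B} \<and> card {B \<in> \<B>. x \<in> constraint_dom B} \<le> d"
    if "x \<in> space M" for x
    using that by (intro size_le) (auto simp: d[symmetric] csp_vdeg_def intro: SUP_upper)
  have dom_le: "card (constraint_dom B) \<le> r" if "B \<in> \<B>" for B
  proof -
    have "set_size (constraint_dom B) \<le> enat r"
      using that by (auto simp: r[symmetric] csp_ord_def intro: SUP_upper)
    then show ?thesis by (auto simp: set_size_def split: if_splits)
  qed
  have dom: "constraint_dom B \<subseteq> space M" if B: "B \<in> \<B>" for B
  proof -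
    obtain D where "D \<subseteq> space M" "B \<subseteq> partial_colorings D k"
      using B assms(3) by (auto simp: borel_csp_def is_csp_def is_constraint_def)
    then show ?thesis by (auto simp: constraint_dom_def partial_colorings_def)
  qed
  have few: "card B * d ^ card (constraint_dom B) < k ^ card (constraint_dom B)" if B: "B \<in> \<B>" for B
  proof -
    let ?n = "card (constraint_dom B)"
    \<comment> \<open>If \<open>d = 0\<close>, all domains are empty and so is the order, which is where \<open>0\<^sup>0 = 1\<close> is needed.\<close>
    have pow: "d ^ ?n \<le> d ^ r"
    proof (cases "d = 0")
      case True
      have "constraint_dom B' = {}" if B': "B' \<in> \<B>" for B'
      proof (rule equals0I)
        fix x assume x: "x \<in> constraint_dom B'"
        then have "x \<in> space M" using dom[OF B'] by blast
        then have "{B \<in> \<B>. x \<in> constraint_dom B} = {}" using incident[of x] True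
          by (metis card_0_eq le_zero_eq)
        then show False using B' x by blast
      qed
      then have "csp_ord \<B> = 0"
        by (auto simp: csp_ord_def set_size_def zero_enat_def[symmetric] bot_enat_def[symmetric])
      then have "r = 0" using r by (simp add: zero_enat_def)
      then show ?thesis using dom_le[OF B] by simp
    next
      case False
      then show ?thesis using dom_le[OF B] by (intro power_increasing) auto
    qed
    have "ennreal (constraint_prob k B * real d ^ r) = ennreal (constraint_prob k B) * of_nat d ^ r"
      by (simp add: ennreal_mult ennreal_power ennreal_of_nat_eq_real_of_nat constraint_prob_def
          del: times_divide_eq_left)
    also have "\<dots> \<le> csp_prob k \<B> * of_nat d ^ r"
      using B by (intro mult_right_mono) (auto simp: csp_prob_def intro: SUP_upper)
    also have "\<dots> < 1" using assms(6) by (simp add: d_def r_def)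
    finally have "constraint_prob k B * real d ^ r < 1"
      by (simp add: ennreal_less_one_iff)
    then have "real (card B) * real d ^ r < real k ^ ?n"
      using \<open>k > 0\<close> by (simp add: constraint_prob_def field_simps)
    then have "card B * d ^ r < k ^ ?n"
      by (metis of_nat_less_iff of_nat_mult of_nat_power)
    then show ?thesis using mult_le_mono2[OF pow, of "card B"] by linarith
  qed
  interpret polish_borel_csp M T k d \<B>
    by unfold_locales (use T assms(2,3) incident few in auto)
  show ?thesis by (rule measurable_solution)
qed

end
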